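(* Let $A,B\in 2^\omega$. The following are equivalent: (i) $A\leq_T B'$ and $A\leq_{LR}B$; (ii) every $\Pi^A_1$ class in $2^\omega$ has a $\Sigma^B_2$ subclass of the same measure; (iii) every $\Sigma^A_2$ class in $2^\omega$ has a $\Sigma^B_2$ subclass of the same measure.
   Context: Subsets of $\omega$ are identified with elements of $2^\omega$; $\mu$ is Lebesgue (fair-coin) measure on $2^\omega$, and "measure" refers to $\mu$. $B'$ is the Turing jump of $B$. For an oracle $A$, a $\Sigma^A_1$ class is a set of the form $\{X\in 2^\omega : \exists\sigma\in W\,(\sigma\sqsubseteq X)\}$ with $W\subseteq 2^{<\omega}$ $A$-c.e.; $\Pi^A_1$ classes are the complements of these; $\Sigma^A_2$ classes are unions of uniformly $A$-effective sequences of $\Pi^A_1$ classes. A subclass is a subset that is a class of the indicated type. For an oracle $A$, a Martin-Löf test relative to $A$ is an $A$-computable (i.e. uniformly $\Sigma^A_1$) nested sequence of $\Sigma^A_1$ classes $U^A_0\supseteq U^A_1\supseteq\cdots$ with $\mu(U^A_n)\leq 2^{-n}$. A set $R$ is $A$-random if $R\notin\bigcap_n U^A_n$ for every such test. $A\leq_{LR}B$ means: every $B$-random set is $A$-random. *)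

theory Defs
  imports "HOL-Probability.Probability" "HOL-Library.Nat_Bijection"
begin

section \<open>Oracle computation\<close>

text \<open>
  Sets of natural numbers are identified with their characteristic functions, i.e. with
  points of Cantor space.
\<close>

type_synonym cantor = "nat \<Rightarrow> bool"

text \<open>
  Programs for the unary partial recursive functions relative to an oracle. Several arguments
  are passed as one number through the pairing function \<^const>\<open>prod_encode\<close>.
\<close>

datatype prog =
    Zero
  | Succ
  | Fst
  | Snd
  | Query
  | Tuple prog prog
  | Comp prog prog
  | Prec prog prog
  | Mu prog

text \<open>
  \<open>evals A p x y\<close>: the program \<open>p\<close> with oracle \<open>A\<close> halts on input \<open>x\<close> with output \<open>y\<close>.
  In rule \<open>Mu\<close>, \<open>p\<close> must halt on all arguments below the zero that is found.
\<close>

inductive evals :: "cantor \<Rightarrow> prog \<Rightarrow> nat \<Rightarrow> nat \<Rightarrow> bool" for A :: cantor where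
  Zero: "evals A Zero x 0"
| Succ: "evals A Succ x (Suc x)"
| Fst: "evals A Fst x (fst (prod_decode x))"
| Snd: "evals A Snd x (snd (prod_decode x))"
| Query: "evals A Query x (of_bool (A x))"
| Tuple: "evals A p x y \<Longrightarrow> evals A q x z \<Longrightarrow> evals A (Tuple p q) x (prod_encode (y, z))"
| Comp: "evals A q x y \<Longrightarrow> evals A p y z \<Longrightarrow> evals A (Comp p q) x z"
| Prec_0: "evals A p x y \<Longrightarrow> evals A (Prec p q) (prod_encode (x, 0)) y"
| Prec_Suc: "evals A (Prec p q) (prod_encode (x, n)) y \<Longrightarrow>
    evals A q (prod_encode (x, prod_encode (n, y))) z \<Longrightarrow>
    evals A (Prec p q) (prod_encode (x, Suc n)) z"
| Mu: "evals A p (prod_encode (x, n)) 0 \<Longrightarrow>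
    (\<And>m. m < n \<Longrightarrow> \<exists>y. 0 < y \<and> evals A p (prod_encode (x, m)) y) \<Longrightarrow>
    evals A (Mu p) x n"

definition halts :: "cantor \<Rightarrow> prog \<Rightarrow> nat \<Rightarrow> bool" where
  "halts A p x \<longleftrightarrow> (\<exists>y. evals A p x y)"

definition turing_le :: "cantor \<Rightarrow> cantor \<Rightarrow> bool"  (infix "\<le>\<^sub>T" 50) where
  "A \<le>\<^sub>T B \<longleftrightarrow> (\<exists>p. \<forall>n. evals B p n (of_bool (A n)))"

definition ce :: "cantor \<Rightarrow> nat set \<Rightarrow> bool" where
  "ce A S \<longleftrightarrow> (\<exists>p. S = {x. halts A p x})"

text \<open>
  Goedel numbers. The numbering is effective and injective with decidable range; a number
  outside the range is regarded as an index of the nowhere defined function, so the jump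
  below is the usual diagonal halting set.
\<close>

fun goedel :: "prog \<Rightarrow> nat" where
  "goedel Zero = prod_encode (0, 0)"
| "goedel Succ = prod_encode (1, 0)"
| "goedel Fst = prod_encode (2, 0)"
| "goedel Snd = prod_encode (3, 0)"
| "goedel Query = prod_encode (4, 0)"
| "goedel (Tuple p q) = prod_encode (5, prod_encode (goedel p, goedel q))"
| "goedel (Comp p q) = prod_encode (6, prod_encode (goedel p, goedel q))"
| "goedel (Prec p q) = prod_encode (7, prod_encode (goedel p, goedel q))"
| "goedel (Mu p) = prod_encode (8, goedel p)"

definition jump :: "cantor \<Rightarrow> cantor" where
  "jump B = (\<lambda>e. \<exists>p. e = goedel p \<and> halts B p e)"


section \<open>Effective classes in Cantor space\<close>

text \<open>Fair-coin measure on Cantor space.\<close>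

definition fair_coin :: "cantor measure" where
  "fair_coin = Pi\<^sub>M UNIV (\<lambda>_. measure_pmf (bernoulli_pmf (1/2)))"

definition initial_segment :: "bool list \<Rightarrow> cantor \<Rightarrow> bool"  (infix "\<sqsubseteq>\<^sub>s" 50) where
  "\<sigma> \<sqsubseteq>\<^sub>s X \<longleftrightarrow> (\<forall>i < length \<sigma>. \<sigma> ! i = X i)"

definition generated_class :: "bool list set \<Rightarrow> cantor set" where
  "generated_class W = {X. \<exists>\<sigma>\<in>W. \<sigma> \<sqsubseteq>\<^sub>s X}"

definition str_code :: "bool list \<Rightarrow> nat" where
  "str_code \<sigma> = list_encode (map of_bool \<sigma>)"

definition sigma1 :: "cantor \<Rightarrow> cantor set \<Rightarrow> bool" where
  "sigma1 A U \<longleftrightarrow> (\<exists>W. ce A (str_code ` W) \<and> U = generated_class W)"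

definition pi1 :: "cantor \<Rightarrow> cantor set \<Rightarrow> bool" where
  "pi1 A P \<longleftrightarrow> sigma1 A (- P)"

text \<open>
  Uniformity in \<open>n\<close> is expressed by \<open>{(n, \<sigma>). \<sigma> \<in> W n}\<close> being c.e. in the oracle.
\<close>

definition uniformly_sigma1 :: "cantor \<Rightarrow> (nat \<Rightarrow> cantor set) \<Rightarrow> bool" where
  "uniformly_sigma1 A U \<longleftrightarrow>
     (\<exists>W. ce A {prod_encode (n, str_code \<sigma>) | n \<sigma>. \<sigma> \<in> W n} \<and> (\<forall>n. U n = generated_class (W n)))"

definition uniformly_pi1 :: "cantor \<Rightarrow> (nat \<Rightarrow> cantor set) \<Rightarrow> bool" where
  "uniformly_pi1 A P \<longleftrightarrow> uniformly_sigma1 A (\<lambda>n. - P n)"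

definition sigma2 :: "cantor \<Rightarrow> cantor set \<Rightarrow> bool" where
  "sigma2 A S \<longleftrightarrow> (\<exists>P. uniformly_pi1 A P \<and> S = (\<Union>n. P n))"


section \<open>Randomness and LR-reducibility\<close>

definition ml_test :: "cantor \<Rightarrow> (nat \<Rightarrow> cantor set) \<Rightarrow> bool" where
  "ml_test A U \<longleftrightarrow> uniformly_sigma1 A U \<and> (\<forall>n. U (Suc n) \<subseteq> U n) \<and>
     (\<forall>n. measure fair_coin (U n) \<le> (1/2) ^ n)"

definition random_rel :: "cantor \<Rightarrow> cantor \<Rightarrow> bool" where
  "random_rel A R \<longleftrightarrow> (\<forall>U. ml_test A U \<longrightarrow> R \<notin> (\<Inter>n. U n))"

definition LR_le :: "cantor \<Rightarrow> cantor \<Rightarrow> bool"  (infix "\<le>\<^sub>L\<^sub>R" 50) where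
  "A \<le>\<^sub>L\<^sub>R B \<longleftrightarrow> (\<forall>R. random_rel B R \<longrightarrow> random_rel A R)"

end

theory Submission
  imports Defs
begin

text \<open>
  Everything hinges on the covering property: every light \<open>A\<close>-c.e. set of weighted indices is
  contained in a light \<open>B\<close>-c.e. one, where light means that the weights
  \<open>(1/2) ^ w i\<close> have a finite sum.  Attach to an index \<open>i\<close> the clopen set \<open>block w i\<close> of that measure, with
  different indices using disjoint coordinates.  By independence, the weight of a set \<open>J\<close> of
  indices is finite as soon as the union of its blocks has measure below one.  Hence any
  \<open>\<Pi>\<^sub>1\<close> class relative to \<open>B\<close> of positive measure yields a light \<open>B\<close>-c.e. set containing all
  indices whose block it misses, and the covering property follows both from the existence of
  \<open>\<Sigma>\<^sub>2\<close> subclasses of full measure and, by forcing with \<open>\<Pi>\<^sub>1\<close> classes of positive measure, from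
  LR-reducibility.  Conversely it gives LR-reducibility by way of Solovay tests.

  For the subclass of a \<open>\<Sigma>\<^sub>2\<close> class relative to \<open>A\<close>, the complements of its components are
  presented by disjoint cylinders, each tagged with the prefix of \<open>A\<close> used to enumerate it.  A
  light \<open>B\<close>-c.e. cover of these pairs contains wrong prefixes as well, but if \<open>A\<close> is computable
  from the jump of \<open>B\<close> then wrong prefixes are eventually recognised, and by the Borel--Cantelli
  lemma discarding them late costs only a null set.
\<close>

section \<open>Computable functions and decidable predicates\<close>

text \<open>The implications are closed into the cycle (i), (iii), (ii), (i). Two obstacles shape
  the argument. To meet a block only in a null set is not evidently an enumerable property of a
  \<open>\<Pi>\<^sub>1\<close> class; what can be enumerated, by approximating an open set from
  below, is that the intersection has measure less than a given positive bound. The light covers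
  therefore use bounds whose sum is less than the measure of the class, so that a part of it with
  positive measure still avoids every enumerated block. Moreover, the complements of the components
  of a \<open>\<Sigma>\<^sub>2\<close> class need not have summable measures, so the
  \<open>n\<close>-th one is weighted with an extra factor \<open>(1/2) ^ n\<close>. This factor is
  constant for each \<open>n\<close>, hence harmless for Borel--Cantelli. The reduction of
  \<open>A\<close> to the jump of \<open>B\<close> from (ii) does not come from covering: the bits
  of \<open>A\<close> and of its complement are coded into \<open>\<Pi>\<^sub>1\<close> classes
  through disjoint cylinders, and a subclass of full measure reveals them to the jump.\<close>

inductive_cases evals_elims:
  "evals A Zero x y" "evals A Succ x y" "evals A Fst x y" "evals A Snd x y" "evals A Query x y"
  "evals A (Tuple p q) x y" "evals A (Comp p q) x y" "evals A (Mu p) x y"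

lemma evals_det: "evals A p x y \<Longrightarrow> evals A p x z \<Longrightarrow> y = z"
proof (induction arbitrary: z rule: evals.induct)
  case (Prec_0 p x y q)
  from Prec_0.prems show ?case
    by (cases rule: evals.cases) (auto intro: Prec_0.IH)
next
  case (Prec_Suc p q x n y z w)
  from Prec_Suc.prems show ?case
    by (cases rule: evals.cases) (auto dest: Prec_Suc.IH)
next
  case (Mu p x n)
  from Mu.prems obtain m where m: "z = m" "evals A p (prod_encode (x, m)) 0"
    "\<And>k. k < m \<Longrightarrow> \<exists>y. 0 < y \<and> evals A p (prod_encode (x, k)) y"
    by (elim evals_elims) auto
  have "\<not> n < m" using m(3) Mu.IH(1) by blast
  moreover have "\<not> m < n" using m(2) Mu.IH(2) by blast
  ultimately show ?case using m(1) by simp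
next
  case (Tuple p x y q w)
  from Tuple.prems show ?case by (elim evals_elims) (auto dest: Tuple.IH)
next
  case (Comp q x y p w)
  from Comp.prems show ?case by (elim evals_elims) (auto dest: Comp.IH)
qed (auto elim: evals_elims)

definition pr1 :: "nat \<Rightarrow> nat" where "pr1 x = fst (prod_decode x)"
definition pr2 :: "nat \<Rightarrow> nat" where "pr2 x = snd (prod_decode x)"
abbreviation pair :: "nat \<Rightarrow> nat \<Rightarrow> nat" where "pair x y \<equiv> prod_encode (x, y)"

lemma pr_pair [simp]: "pr1 (pair x y) = x" "pr2 (pair x y) = y"
  by (simp_all add: pr1_def pr2_def)

lemma pair_pr [simp]: "pair (pr1 x) (pr2 x) = x"
  by (simp add: pr1_def pr2_def)

lemma pr_0 [simp]: "pr1 0 = 0" "pr2 0 = 0"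
  by (simp_all add: pr1_def pr2_def prod_decode_def prod_decode_aux.simps)

lemma pr1_le: "pr1 x \<le> x"
  using le_prod_encode_1[of "pr1 x" "pr2 x"] by simp

lemma all_pair: "(\<forall>z. P z) \<longleftrightarrow> (\<forall>x y. P (pair x y))"
  by (metis pair_pr)

lemma ex_pair: "(\<exists>z. P z) \<longleftrightarrow> (\<exists>x y. P (pair x y))"
  by (metis pair_pr)

definition computable :: "cantor \<Rightarrow> (nat \<Rightarrow> nat) \<Rightarrow> bool" where
  "computable A f \<longleftrightarrow> (\<exists>p. \<forall>x. evals A p x (f x))"

definition decidable :: "cantor \<Rightarrow> (nat \<Rightarrow> bool) \<Rightarrow> bool" where
  "decidable A P \<longleftrightarrow> computable A (\<lambda>x. of_bool (P x))"

named_theorems computable_intros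

lemma computable_id [computable_intros]: "computable A (\<lambda>x. x)"
  unfolding computable_def
  using evals.Tuple[OF evals.Fst evals.Snd, of A]
  by (intro exI[of _ "Tuple Fst Snd"]) simp

lemma computable_compose: "computable A f \<Longrightarrow> computable A g \<Longrightarrow> computable A (\<lambda>x. f (g x))"
  unfolding computable_def by (blast intro: evals.Comp)

lemma computable_pair [computable_intros]: "computable A f \<Longrightarrow> computable A g \<Longrightarrow> computable A (\<lambda>x. pair (f x) (g x))"
  unfolding computable_def by (blast intro: evals.Tuple)

text \<open>A function of two arguments is treated as a function of the code \<open>z\<close> of its
  argument pair. This rule applies it to computable arguments without exposing the code.\<close>

lemma computable_compose2:
  assumes "computable A (\<lambda>z. f (pr1 z) (pr2 z))" "computable A g" "computable A h"
  shows "computable A (\<lambda>x. f (g x) (h x))"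
  using computable_compose[OF assms(1) computable_pair[OF assms(2,3)]] by simp

lemma computable_Suc [computable_intros]: "computable A f \<Longrightarrow> computable A (\<lambda>x. Suc (f x))"
  by (rule computable_compose[of A Suc]) (use evals.Succ[of A] in \<open>auto simp only: computable_def\<close>)

lemma computable_pr1 [computable_intros]: "computable A f \<Longrightarrow> computable A (\<lambda>x. pr1 (f x))"
  by (rule computable_compose[of A pr1]) (use evals.Fst[of A] in \<open>auto simp only: computable_def pr1_def\<close>)

lemma computable_pr2 [computable_intros]: "computable A f \<Longrightarrow> computable A (\<lambda>x. pr2 (f x))"
  by (rule computable_compose[of A pr2]) (use evals.Snd[of A] in \<open>auto simp only: computable_def pr2_def\<close>)

lemma computable_oracle [computable_intros]: "computable A f \<Longrightarrow> decidable A (\<lambda>x. A (f x))"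
  unfolding decidable_def
  by (rule computable_compose[of A "\<lambda>x. of_bool (A x)"]) (use evals.Query[of A] in \<open>auto simp only: computable_def\<close>)

lemma computable_const [computable_intros]: "computable A (\<lambda>x. c)"
proof (induction c)
  case 0
  show ?case unfolding computable_def using evals.Zero by blast
qed (rule computable_Suc)

lemma computable_rec_nat:
  assumes f: "computable A f" and g: "computable A (\<lambda>z. g (pr1 z) (pr1 (pr2 z)) (pr2 (pr2 z)))" and h: "computable A h"
  shows "computable A (\<lambda>x. rec_nat (f x) (\<lambda>n y. g x n y) (h x))"
proof -
  obtain p q where p: "\<And>x. evals A p x (f x)"
    and q: "\<And>z. evals A q z (g (pr1 z) (pr1 (pr2 z)) (pr2 (pr2 z)))"
    using f g unfolding computable_def by blast
  have "evals A (Prec p q) (pair x n) (rec_nat (f x) (\<lambda>n y. g x n y) n)" for x n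
  proof (induction n)
    case (Suc n)
    from q[of "pair x (pair n (rec_nat (f x) (\<lambda>n y. g x n y) n))"] show ?case
      by (auto intro!: evals.Prec_Suc[OF Suc])
  qed (simp add: evals.Prec_0 p)
  from this[of "pr1 z" "pr2 z" for z]
  have "computable A (\<lambda>z. rec_nat (f (pr1 z)) (\<lambda>n y. g (pr1 z) n y) (pr2 z))"
    unfolding computable_def by auto
  from computable_compose[OF this, of "\<lambda>x. pair x (h x)"] show ?thesis
    by (simp add: computable_pair computable_id h)
qed


section \<open>Arithmetic, logical connectives, bounded quantifiers and search\<close>

lemma rec_nat_arith:
  "rec_nat a (\<lambda>_. Suc) b = a + b"
  "rec_nat a (\<lambda>_ y. y - 1) b = a - b"
  "rec_nat 0 (\<lambda>_ y. y + a) b = a * b"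
  "rec_nat 1 (\<lambda>_ y. y + y) b = (2::nat) ^ b"
  "rec_nat 0 (\<lambda>n _. n) b = b - 1"
  by (induction b) auto

lemma computable_pred: assumes "computable A f" shows "computable A (\<lambda>x. f x - 1)"
proof -
  have "computable A (\<lambda>x. rec_nat 0 (\<lambda>n _. n) (f x))"
    by (intro computable_rec_nat computable_intros assms)
  then show ?thesis unfolding rec_nat_arith .
qed

lemma computable_add [computable_intros]: assumes "computable A f" "computable A g" shows "computable A (\<lambda>x. f x + g x)"
proof -
  have "computable A (\<lambda>x. rec_nat (f x) (\<lambda>n y. Suc y) (g x))"
    by (intro computable_rec_nat computable_intros assms)
  then show ?thesis unfolding rec_nat_arith .
qed

lemma computable_diff [computable_intros]: assumes "computable A f" "computable A g" shows "computable A (\<lambda>x. f x - g x)"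
proof -
  have "computable A (\<lambda>x. rec_nat (f x) (\<lambda>n y. y - 1) (g x))"
    by (intro computable_rec_nat computable_intros computable_pred assms)
  then show ?thesis unfolding rec_nat_arith .
qed

lemma computable_mult [computable_intros]: assumes "computable A f" "computable A g" shows "computable A (\<lambda>x. f x * g x)"
proof -
  have "computable A (\<lambda>x. rec_nat 0 (\<lambda>n y. y + f x) (g x))"
    by (intro computable_rec_nat computable_intros assms computable_compose[OF assms(1)])
  then show ?thesis unfolding rec_nat_arith .
qed

lemma computable_power2 [computable_intros]: assumes "computable A f" shows "computable A (\<lambda>x. 2 ^ f x)"
proof -
  have "computable A (\<lambda>x. rec_nat 1 (\<lambda>n y. y + y) (f x))"
    by (intro computable_rec_nat computable_intros assms)
  then show ?thesis unfolding rec_nat_arith .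
qed

lemma computable_of_bool [computable_intros]: "decidable A P \<Longrightarrow> computable A (\<lambda>x. of_bool (P x))"
  by (simp add: decidable_def)

lemma decidable_compose: "decidable A P \<Longrightarrow> computable A f \<Longrightarrow> decidable A (\<lambda>x. P (f x))"
  unfolding decidable_def by (rule computable_compose)

lemma decidable_compose2:
  assumes "decidable A (\<lambda>z. P (pr1 z) (pr2 z))" "computable A g" "computable A h"
  shows "decidable A (\<lambda>x. P (g x) (h x))"
  using assms unfolding decidable_def by (rule computable_compose2)

lemma computable_if [computable_intros]:
  assumes "decidable A P" "computable A f" "computable A g" shows "computable A (\<lambda>x. if P x then f x else g x)"
proof -
  have "computable A (\<lambda>x. of_bool (P x) * f x + (1 - of_bool (P x)) * g x)"
    by (intro computable_intros assms)
  moreover have "(\<lambda>x. of_bool (P x) * f x + (1 - of_bool (P x)) * g x) = (\<lambda>x. if P x then f x else g x)"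
    by auto
  ultimately show ?thesis by simp
qed

lemma decidable_const [computable_intros]: "decidable A (\<lambda>x. c)"
  unfolding decidable_def by (rule computable_const)

lemma decidable_not [computable_intros]: assumes "decidable A P" shows "decidable A (\<lambda>x. \<not> P x)"
proof -
  have "computable A (\<lambda>x. 1 - of_bool (P x))" by (intro computable_intros assms)
  moreover have "(\<lambda>x. 1 - of_bool (P x)) = (\<lambda>x. of_bool (\<not> P x) :: nat)" by auto
  ultimately show ?thesis by (simp add: decidable_def)
qed

lemma decidable_and [computable_intros]: assumes "decidable A P" "decidable A Q" shows "decidable A (\<lambda>x. P x \<and> Q x)"
proof -
  have "computable A (\<lambda>x. of_bool (P x) * of_bool (Q x))" by (intro computable_intros assms)
  then show ?thesis by (simp add: decidable_def of_bool_conj)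
qed

lemma decidable_or [computable_intros]: assumes "decidable A P" "decidable A Q" shows "decidable A (\<lambda>x. P x \<or> Q x)"
  using decidable_not[OF decidable_and[OF decidable_not[OF assms(1)] decidable_not[OF assms(2)]]] by simp

lemma decidable_imp [computable_intros]: assumes "decidable A P" "decidable A Q" shows "decidable A (\<lambda>x. P x \<longrightarrow> Q x)"
  using decidable_or[OF decidable_not[OF assms(1)] assms(2)] unfolding imp_conv_disj .

lemma decidable_less [computable_intros]: assumes "computable A f" "computable A g" shows "decidable A (\<lambda>x. f x < g x)"
proof -
  have "1 - (1 - (g x - f x)) = of_bool (f x < g x)" for x by simp
  moreover have "computable A (\<lambda>x. 1 - (1 - (g x - f x)))" by (intro computable_intros assms)
  ultimately show ?thesis unfolding decidable_def by (simp only:)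
qed

lemma decidable_le [computable_intros]: assumes "computable A f" "computable A g" shows "decidable A (\<lambda>x. f x \<le> g x)"
  using decidable_not[OF decidable_less[OF assms(2,1)]] by (simp add: not_less)

lemma decidable_eq [computable_intros]: assumes "computable A f" "computable A g" shows "decidable A (\<lambda>x. f x = g x)"
proof -
  have "(\<lambda>x. f x = g x) = (\<lambda>x. f x \<le> g x \<and> g x \<le> f x)" by auto
  show ?thesis unfolding \<open>(\<lambda>x. f x = g x) = _\<close> by (intro computable_intros assms)
qed

lemma rec_nat_all: "rec_nat 1 (\<lambda>i y. if P i then y else 0) n = (of_bool (\<forall>i<n. P i) :: nat)"
  by (induction n) (auto simp: less_Suc_eq)

lemma decidable_ball [computable_intros]:
  assumes "decidable A (\<lambda>z. P (pr1 z) (pr2 z))" "computable A n"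
  shows "decidable A (\<lambda>x. \<forall>i<n x. P x i)"
proof -
  have "computable A (\<lambda>x. rec_nat 1 (\<lambda>i y. if P x i then y else 0) (n x))"
    by (intro computable_rec_nat decidable_compose2[OF assms(1)] computable_intros assms(2))
  then show ?thesis unfolding rec_nat_all decidable_def .
qed

lemma decidable_bex [computable_intros]:
  assumes "decidable A (\<lambda>z. P (pr1 z) (pr2 z))" "computable A n"
  shows "decidable A (\<lambda>x. \<exists>i<n x. P x i)"
  using decidable_not[OF decidable_ball[OF decidable_not[OF assms(1)] assms(2)]] by simp

lemma decidable_bex_le [computable_intros]:
  assumes "decidable A (\<lambda>z. P (pr1 z) (pr2 z))" "computable A n"
  shows "decidable A (\<lambda>x. \<exists>i\<le>n x. P x i)"
  using decidable_bex[OF assms(1) computable_Suc[OF assms(2)]] by (simp add: less_Suc_eq_le)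

lemma computable_Least:
  assumes P: "decidable A (\<lambda>z. P (pr1 z) (pr2 z))" and ex: "\<And>x. \<exists>n. P x n"
  shows "computable A (\<lambda>x. LEAST n. P x n)"
proof -
  \<comment> \<open>\<open>Mu\<close> looks for a zero, so it is applied to the characteristic
    function of the negation.\<close>
  have "computable A (\<lambda>z. of_bool (\<not> P (pr1 z) (pr2 z)))" by (intro computable_intros P)
  then obtain p where p: "\<And>z. evals A p z (of_bool (\<not> P (pr1 z) (pr2 z)))"
    unfolding computable_def by blast
  have p': "evals A p (pair x n) (of_bool (\<not> P x n))" for x n using p[of "pair x n"] by simp
  have "evals A (Mu p) x (LEAST n. P x n)" for x
  proof (rule evals.Mu)
    show "evals A p (pair x (LEAST n. P x n)) 0"
      using p'[of x "LEAST n. P x n"] LeastI_ex[OF ex[of x]] by simp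
    fix m assume "m < (LEAST n. P x n)"
    then have "\<not> P x m" by (rule not_less_Least)
    then show "\<exists>y>0. evals A p (pair x m) y" using p'[of x m] by (intro exI[of _ 1]) auto
  qed
  then show ?thesis unfolding computable_def by blast
qed


section \<open>Coded lists\<close>

definition len :: "nat \<Rightarrow> nat" where "len c = length (list_decode c)"
text \<open>The default value 0 is what reading a head from the code 0 of the empty list yields, so
  no case distinction is needed to compute the function.\<close>

definition nthc :: "nat \<Rightarrow> nat \<Rightarrow> nat" where
  "nthc c m = (if m < len c then list_decode c ! m else 0)"
definition dropc :: "nat \<Rightarrow> nat \<Rightarrow> nat" where
  "dropc c m = list_encode (drop m (list_decode c))"
definition takec :: "nat \<Rightarrow> nat \<Rightarrow> nat" where
  "takec m c = list_encode (take m (list_decode c))"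
definition elems :: "nat \<Rightarrow> nat set" where "elems c = set (list_decode c)"

text \<open>This includes the empty list: truncated subtraction keeps its code at 0, and
  \<open>pr2 0 = 0\<close> codes the empty list again.\<close>

lemma list_decode_tl: "list_decode (pr2 (c - 1)) = tl (list_decode c)"
  by (cases c) (simp, simp add: pr2_def split: prod.split)

lemma list_decode_hd: "pr1 (c - 1) = (if c = 0 then 0 else hd (list_decode c))"
  by (cases c) (simp, simp add: pr1_def split: prod.split)

lemma list_decode_eq_Nil: "list_decode c = [] \<longleftrightarrow> c = 0"
  by (metis list_decode.simps(1) list_decode_inverse)

lemma rec_nat_dropc: "rec_nat c (\<lambda>_ y. pr2 (y - 1)) m = dropc c m"
proof (induction m)
  case (Suc m)
  have "list_decode (pr2 (dropc c m - 1)) = drop (Suc m) (list_decode c)"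
    unfolding list_decode_tl by (simp add: dropc_def drop_Suc tl_drop)
  then have "pr2 (dropc c m - 1) = dropc c (Suc m)"
    by (metis dropc_def list_decode_inverse)
  then show ?case using Suc by simp
qed (simp add: dropc_def)

lemma computable_dropc [computable_intros]:
  assumes "computable A f" "computable A g" shows "computable A (\<lambda>x. dropc (f x) (g x))"
proof -
  have "computable A (\<lambda>x. rec_nat (f x) (\<lambda>n y. pr2 (y - 1)) (g x))"
    by (intro computable_rec_nat computable_intros assms)
  then show ?thesis unfolding rec_nat_dropc .
qed

lemma dropc_eq_0: "dropc c m = 0 \<longleftrightarrow> len c \<le> m"
proof -
  have "dropc c m = 0 \<longleftrightarrow> drop m (list_decode c) = []"
    by (metis dropc_def list_decode_eq_Nil list_encode_inverse)
  then show ?thesis by (simp add: len_def)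
qed

lemma computable_len [computable_intros]:
  assumes "computable A f" shows "computable A (\<lambda>x. len (f x))"
proof -
  have "computable A (\<lambda>c. LEAST m. dropc c m = 0)"
    by (intro computable_Least computable_intros) (auto simp: dropc_eq_0)
  moreover have "(LEAST m. dropc c m = 0) = len c" for c
    unfolding dropc_eq_0 by (rule Least_equality) auto
  ultimately show ?thesis using assms computable_compose by simp
qed

lemma computable_nthc [computable_intros]:
  assumes "computable A f" "computable A g" shows "computable A (\<lambda>x. nthc (f x) (g x))"
proof -
  have "pr1 (dropc c m - 1) = nthc c m" for c m
    unfolding list_decode_hd dropc_eq_0 nthc_def
    by (auto simp: dropc_def len_def hd_drop_conv_nth)
  moreover have "computable A (\<lambda>x. pr1 (dropc (f x) (g x) - 1))"
    by (intro computable_intros assms)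
  ultimately show ?thesis by simp
qed

lemma computable_tabulate [computable_intros]:
  assumes f: "computable A (\<lambda>z. f (pr1 z) (pr2 z))" and n: "computable A n"
  shows "computable A (\<lambda>x. list_encode (map (f x) [0..<n x]))"
proof -
  \<comment> \<open>Codes grow at the front, so the recursion runs backwards: after \<open>j\<close>
    rounds it holds the last \<open>j\<close> entries.\<close>
  have rec: "rec_nat 0 (\<lambda>j y. Suc (pair (f x (N - Suc j)) y)) j = list_encode (map (f x) [N - j..<N])"
    if "j \<le> N" for x j N
    using that
  proof (induction j)
    case (Suc j)
    then have "[N - Suc j..<N] = (N - Suc j) # [N - j..<N]"
      by (simp add: upt_conv_Cons Suc_diff_Suc)
    then show ?case using Suc by simp
  qed simp
  have "computable A (\<lambda>x. rec_nat 0 (\<lambda>j y. Suc (pair (f x (n x - Suc j)) y)) (n x))"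
    by (intro computable_rec_nat computable_compose2[OF f] computable_compose[OF n] computable_intros n)
  then show ?thesis by (simp add: rec)
qed

lemma takec_eq: "takec m c = list_encode (map (nthc c) [0..<min m (len c)])"
  unfolding takec_def len_def nthc_def by (intro arg_cong[of _ _ list_encode] nth_equalityI) auto

lemma computable_min [computable_intros]:
  "computable A f \<Longrightarrow> computable A g \<Longrightarrow> computable A (\<lambda>x. min (f x) (g x))"
  unfolding min_def by (intro computable_intros)

lemma computable_takec [computable_intros]:
  assumes "computable A f" "computable A g" shows "computable A (\<lambda>x. takec (f x) (g x))"
  unfolding takec_eq
  by (intro computable_intros assms computable_compose[OF assms(1)] computable_compose[OF assms(2)])

lemma elems_iff: "d \<in> elems c \<longleftrightarrow> (\<exists>m<len c. nthc c m = d)"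
  by (auto simp: elems_def len_def nthc_def in_set_conv_nth)

lemma decidable_elems [computable_intros]:
  assumes "computable A f" "computable A g" shows "decidable A (\<lambda>x. f x \<in> elems (g x))"
  unfolding elems_iff
  by (intro computable_intros assms computable_compose[OF assms(1)] computable_compose[OF assms(2)])

lemma decidable_distinct [computable_intros]:
  assumes "computable A f" shows "decidable A (\<lambda>x. distinct (list_decode (f x)))"
proof -
  have *: "distinct (list_decode c) \<longleftrightarrow> (\<forall>m<len c. \<forall>k<m. nthc c k \<noteq> nthc c m)" for c
  proof -
    have "(\<forall>i<n. \<forall>j<n. i \<noteq> j \<longrightarrow> f i \<noteq> f j) \<longleftrightarrow> (\<forall>m<n. \<forall>k<m. f k \<noteq> f m)" for f :: "nat \<Rightarrow> nat" and n
      by (intro iffI allI impI) (simp, metis linorder_neqE_nat)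
    then show ?thesis by (simp add: distinct_conv_nth len_def nthc_def)
  qed
  show ?thesis unfolding *
    by (intro computable_intros assms computable_compose[OF assms(1)])
qed

lemma list_encode_ge: "x \<in> set l \<Longrightarrow> x \<le> list_encode l"
proof (induction l)
  case (Cons a l)
  then show ?case
    using le_prod_encode_1[of a "list_encode l"] le_prod_encode_2[of "list_encode l" a] by auto
qed simp

lemma elems_le: "x \<in> elems c \<Longrightarrow> x \<le> c"
  using list_encode_ge[of x "list_decode c"] by (simp add: elems_def)

section \<open>Coded prefixes of points of Cantor space\<close>

definition restr :: "cantor \<Rightarrow> nat \<Rightarrow> nat" where "restr X k = str_code (map X [0..<k])"

lemma list_decode_restr: "list_decode (restr X k) = map (\<lambda>i. of_bool (X i)) [0..<k]"
  by (simp add: restr_def str_code_def o_def)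

lemma len_restr [simp]: "len (restr X k) = k"
  by (simp add: len_def list_decode_restr)

lemma nthc_restr: "nthc (restr X k) m = (if m < k then of_bool (X m) else 0)"
  by (simp add: nthc_def list_decode_restr)

lemma takec_restr [simp]: "takec j (restr X k) = restr X (min j k)"
  by (simp add: takec_def list_decode_restr take_map)
     (simp add: restr_def str_code_def o_def take_upt min_def)

lemma restr_eq_iff: "restr X k = restr Y k \<longleftrightarrow> (\<forall>i<k. X i = Y i)"
proof
  assume "restr X k = restr Y k"
  then have "nthc (restr X k) i = nthc (restr Y k) i" for i by simp
  then show "\<forall>i<k. X i = Y i" unfolding nthc_restr by (metis of_bool_eq_iff)
qed (auto simp: restr_def intro!: arg_cong[of _ _ str_code])

lemma computable_restr [computable_intros]:
  assumes X: "decidable A X" and k: "computable A k" shows "computable A (\<lambda>x. restr X (k x))"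
proof -
  have "computable A (\<lambda>x. list_encode (map (\<lambda>i. of_bool (X i)) [0..<k x]))"
    by (intro computable_intros k decidable_compose[OF X])
  then show ?thesis by (simp add: restr_def str_code_def o_def)
qed

definition is_str :: "nat \<Rightarrow> bool" where "is_str c \<longleftrightarrow> (\<forall>m<len c. nthc c m \<le> 1)"

lemma decidable_is_str [computable_intros]: assumes "computable A f" shows "decidable A (\<lambda>x. is_str (f x))"
  unfolding is_str_def by (intro computable_intros assms computable_compose[OF assms(1)])

lemma is_str_restr [simp]: "is_str (restr X k)"
  by (simp add: is_str_def nthc_restr)

lemma is_str_iff: "is_str c \<longleftrightarrow> (\<exists>\<sigma>. c = str_code \<sigma>)"
proof
  assume c: "is_str c"
  define \<sigma> where "\<sigma> = map (\<lambda>x. x = (1::nat)) (list_decode c)"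
  have "(of_bool (x = 1) :: nat) = x" if "x \<in> set (list_decode c)" for x
  proof -
    obtain m where "m < len c" "nthc c m = x" using \<open>x \<in> _\<close> elems_iff by (auto simp: elems_def)
    then have "x \<le> 1" using c by (auto simp: is_str_def)
    then show ?thesis by (cases x) auto
  qed
  then have "map of_bool \<sigma> = list_decode c"
    unfolding \<sigma>_def by (simp add: map_idI)
  then show "\<exists>\<sigma>. c = str_code \<sigma>" by (metis list_decode_inverse str_code_def)
qed (auto simp: is_str_def str_code_def nthc_def len_def)

lemma str_code_inj: "str_code \<sigma> = str_code \<tau> \<longleftrightarrow> \<sigma> = \<tau>"
proof
  assume "str_code \<sigma> = str_code \<tau>"
  then have "map (of_bool :: bool \<Rightarrow> nat) \<sigma> = map of_bool \<tau>"
    by (metis str_code_def list_encode_inverse)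
  then show "\<sigma> = \<tau>" by (rule map_injective) (auto simp: inj_def)
qed simp

lemma initial_segment_iff: "\<sigma> \<sqsubseteq>\<^sub>s X \<longleftrightarrow> str_code \<sigma> = restr X (length \<sigma>)"
  unfolding initial_segment_def restr_def str_code_inj
  by (subst list_eq_iff_nth_eq) simp

lemma len_str_code [simp]: "len (str_code \<sigma>) = length \<sigma>"
  by (simp add: len_def str_code_def)


section \<open>Derivations as coded lists, and the normal form theorem\<close>

text \<open>Derivations in reverse order: the premises of an entry stand behind it, so that a new
  conclusion is consed to the front.\<close>

fun valid :: "(nat set \<Rightarrow> nat \<Rightarrow> bool) \<Rightarrow> nat list \<Rightarrow> bool" where
  "valid J [] \<longleftrightarrow> True"
| "valid J (d # l) \<longleftrightarrow> J (set l) d \<and> valid J l"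

lemma valid_iff:
  "valid J (list_decode c) \<longleftrightarrow> (\<forall>m<len c. J (elems (dropc c (Suc m))) (nthc c m))"
proof -
  have "valid J l \<longleftrightarrow> (\<forall>m<length l. J (set (drop (Suc m) l)) (l ! m))" for l
    by (induction l) (auto simp: less_Suc_eq_0_disj)
  then show ?thesis by (simp add: len_def elems_def dropc_def nthc_def)
qed

lemma decidable_valid:
  assumes J: "decidable A (\<lambda>z. J (pr1 z) (elems (pr1 (pr2 z))) (pr2 (pr2 z)))"
    and f: "computable A f" and g: "computable A g"
  shows "decidable A (\<lambda>x. valid (J (f x)) (list_decode (g x)))"
proof -
  let ?h = "\<lambda>z. pair (f (pr1 z)) (pair (dropc (g (pr1 z)) (Suc (pr2 z))) (nthc (g (pr1 z)) (pr2 z)))"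
  have "computable A ?h"
    by (intro computable_intros computable_compose[OF f] computable_compose[OF g])
  from decidable_compose[OF J this] show ?thesis unfolding valid_iff
    by (intro decidable_ball) (simp_all add: computable_intros g)
qed

lemma valid_append:
  assumes "\<And>r r' d. J r d \<Longrightarrow> r \<subseteq> r' \<Longrightarrow> J r' d"
  shows "valid J l \<Longrightarrow> valid J l' \<Longrightarrow> valid J (l @ l')"
  by (induction l) (auto intro: assms)

lemma valid_mono:
  assumes "\<And>r d. J r d \<Longrightarrow> J' r d"
  shows "valid J l \<Longrightarrow> valid J' l"
  by (induction l) (auto intro: assms)

abbreviation triple :: "nat \<Rightarrow> nat \<Rightarrow> nat \<Rightarrow> nat" where
  "triple e x y \<equiv> pair e (pair x y)"

text \<open>
  The rules of \<^const>\<open>evals\<close> for triples (program, input, output), with premises taken from \<open>r\<close>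
  and oracle questions answered by the string coded by \<open>\<tau>\<close>.
\<close>

definition step :: "nat \<Rightarrow> nat set \<Rightarrow> nat \<Rightarrow> nat \<Rightarrow> nat \<Rightarrow> bool" where
  "step \<tau> r e x y \<longleftrightarrow>
     pr1 e = 0 \<and> y = 0 \<or>
     pr1 e = 1 \<and> y = Suc x \<or>
     pr1 e = 2 \<and> y = pr1 x \<or>
     pr1 e = 3 \<and> y = pr2 x \<or>
     pr1 e = 4 \<and> x < len \<tau> \<and> y = nthc \<tau> x \<or>
     pr1 e = 5 \<and> triple (pr1 (pr2 e)) x (pr1 y) \<in> r \<and> triple (pr2 (pr2 e)) x (pr2 y) \<in> r \<or>
     pr1 e = 6 \<and> (\<exists>z. triple (pr2 (pr2 e)) x z \<in> r \<and> triple (pr1 (pr2 e)) z y \<in> r) \<or>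
     pr1 e = 7 \<and> pr2 x = 0 \<and> triple (pr1 (pr2 e)) (pr1 x) y \<in> r \<or>
     pr1 e = 7 \<and> pr2 x > 0 \<and> (\<exists>z. triple e (pair (pr1 x) (pr2 x - 1)) z \<in> r \<and>
        triple (pr2 (pr2 e)) (triple (pr1 x) (pr2 x - 1) z) y \<in> r) \<or>
     pr1 e = 8 \<and> triple (pr2 e) (pair x y) 0 \<in> r \<and>
        (\<forall>m<y. \<exists>z. 0 < z \<and> triple (pr2 e) (pair x m) z \<in> r)"

definition stepd :: "nat \<Rightarrow> nat set \<Rightarrow> nat \<Rightarrow> bool" where
  "stepd \<tau> r d \<longleftrightarrow> step \<tau> r (pr1 d) (pr1 (pr2 d)) (pr2 (pr2 d))"

text \<open>Entries of a coded list are bounded by its code, so the intermediate values in the rules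
  for composition, recursion and search range over a bounded set, and the rules become
  decidable.\<close>

lemma ex_triple_bounded:
  "(\<exists>z. triple a b z \<in> elems c \<and> P z) \<longleftrightarrow> (\<exists>z\<le>c. triple a b z \<in> elems c \<and> P z)"
proof -
  have "z \<le> c" if "triple a b z \<in> elems c" for z
    using elems_le[OF that] le_prod_encode_2[of z b] le_prod_encode_2[of "pair b z" a] by linarith
  then show ?thesis by blast
qed

lemma decidable_stepd: "decidable A (\<lambda>z. stepd (pr1 z) (elems (pr1 (pr2 z))) (pr2 (pr2 z)))"
proof -
  have *: "(\<exists>z. 0 < z \<and> triple a b z \<in> elems c) \<longleftrightarrow> (\<exists>z\<le>c. triple a b z \<in> elems c \<and> 0 < z)" for a b c
    using ex_triple_bounded[of a b c "\<lambda>z. 0 < z"] by blast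
  show ?thesis
    unfolding stepd_def step_def ex_triple_bounded * by (intro computable_intros)
qed

lemma step_mono:
  assumes "step (restr A k) r e x y" "k \<le> k'" "r \<subseteq> r'"
  shows "step (restr A k') r' e x y"
proof -
  have q: "x < len (restr A k') \<and> y = nthc (restr A k') x"
    if "x < len (restr A k) \<and> y = nthc (restr A k) x"
    using that assms(2) by (auto simp: nthc_restr)
  show ?thesis
    using assms(1) unfolding step_def
    by (elim disj_forward) (use q assms(3) in blast)+
qed

definition derivable :: "cantor \<Rightarrow> nat \<Rightarrow> bool" where
  "derivable A d \<longleftrightarrow> (\<exists>k l. valid (stepd (restr A k)) l \<and> d \<in> set l)"

lemma valid_stepd_append:
  assumes "valid (stepd (restr A k)) l" "valid (stepd (restr A k')) l'"
  shows "valid (stepd (restr A (max k k'))) (l @ l')"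
proof (rule valid_append)
  have mono: "stepd (restr A i) r d \<Longrightarrow> i \<le> j \<Longrightarrow> r \<subseteq> r' \<Longrightarrow> stepd (restr A j) r' d" for i j r r' d
    unfolding stepd_def by (rule step_mono)
  show "valid (stepd (restr A (max k k'))) l" "valid (stepd (restr A (max k k'))) l'"
    using assms by (auto elim!: valid_mono[rotated] intro: mono)
  show "stepd (restr A (max k k')) r d \<Longrightarrow> r \<subseteq> r' \<Longrightarrow> stepd (restr A (max k k')) r' d" for r r' d
    by (rule mono) auto
qed

text \<open>The number of premises of the \<open>Mu\<close> rule depends on the output, so
  derivations have to be merged for an arbitrary finite set of premises, over a common oracle
  prefix.\<close>

lemma derivable_finite:
  assumes "finite F" "\<And>d. d \<in> F \<Longrightarrow> derivable A d"
  shows "\<exists>k l. valid (stepd (restr A k)) l \<and> F \<subseteq> set l"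
  using assms
proof (induction F)
  case empty
  show ?case by (intro exI[of _ 0] exI[of _ "[]"]) simp
next
  case (insert d F)
  then obtain k l k' l' where "valid (stepd (restr A k)) l" "F \<subseteq> set l"
    "valid (stepd (restr A k')) l'" "d \<in> set l'"
    unfolding derivable_def by (meson insertCI)
  then show ?case using valid_stepd_append
    by (intro exI[of _ "max k k'"] exI[of _ "l @ l'"]) auto
qed

lemma derivable_step:
  assumes "finite F" "\<And>d. d \<in> F \<Longrightarrow> derivable A d" "step (restr A k) F e x y"
  shows "derivable A (triple e x y)"
proof -
  obtain k' l where l: "valid (stepd (restr A k')) l" "F \<subseteq> set l"
    using derivable_finite[OF assms(1,2)] by blast
  have "valid (stepd (restr A (max k k'))) ([] @ l)"
    by (rule valid_stepd_append) (use l in auto)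
  moreover have "step (restr A (max k k')) (set l) e x y"
    by (rule step_mono[OF assms(3)]) (use l in auto)
  ultimately have "valid (stepd (restr A (max k k'))) (triple e x y # l)"
    by (simp add: stepd_def)
  then show ?thesis unfolding derivable_def by (meson list.set_intros(1))
qed

lemma evals_derivable: "evals A p x y \<Longrightarrow> derivable A (triple (goedel p) x y)"
proof (induction rule: evals.induct)
  case (Zero x)
  show ?case by (rule derivable_step[of "{}" _ 0]) (auto simp: step_def)
next
  case (Succ x)
  show ?case by (rule derivable_step[of "{}" _ 0]) (auto simp: step_def)
next
  case (Fst x)
  show ?case by (rule derivable_step[of "{}" _ 0]) (auto simp: step_def pr1_def)
next
  case (Snd x)
  show ?case by (rule derivable_step[of "{}" _ 0]) (auto simp: step_def pr2_def pr1_def)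
next
  case (Query x)
  \<comment> \<open>A prefix answers the query at \<open>x\<close> only if it is longer than
    \<open>x\<close>.\<close>
  show ?case by (rule derivable_step[of "{}" _ "Suc x"]) (auto simp: step_def nthc_restr)
next
  case (Tuple p x y q z)
  show ?case
    by (rule derivable_step[of "{triple (goedel p) x y, triple (goedel q) x z}" _ 0])
       (use Tuple.IH in \<open>auto simp: step_def\<close>)
next
  case (Comp q x y p z)
  show ?case
    by (rule derivable_step[of "{triple (goedel q) x y, triple (goedel p) y z}" _ 0])
       (use Comp.IH in \<open>auto simp: step_def\<close>)
next
  case (Prec_0 p x y q)
  show ?case
    by (rule derivable_step[of "{triple (goedel p) x y}" _ 0])
       (use Prec_0.IH in \<open>auto simp: step_def\<close>)
next
  case (Prec_Suc p q x n y z)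
  show ?case
    by (rule derivable_step[of "{triple (goedel (Prec p q)) (pair x n) y,
          triple (goedel q) (triple x n y) z}" _ 0])
       (use Prec_Suc.IH in \<open>auto simp: step_def\<close>)
next
  case (Mu p x n)
  then obtain f where f: "\<And>m. m < n \<Longrightarrow> 0 < f m \<and> derivable A (triple (goedel p) (pair x m) (f m))"
    by metis
  show ?case
    by (rule derivable_step[of "insert (triple (goedel p) (pair x n) 0)
          ((\<lambda>m. triple (goedel p) (pair x m) (f m)) ` {..<n})" _ 0])
       (use Mu.IH f in \<open>auto simp: step_def\<close>)
qed

lemma valid_evals:
  "valid (stepd (restr A k)) l \<Longrightarrow> triple (goedel p) x y \<in> set l \<Longrightarrow> evals A p x y"
proof (induction l arbitrary: p x y)
  case (Cons d l)
  then have IH: "\<And>p x y. triple (goedel p) x y \<in> set l \<Longrightarrow> evals A p x y" by simp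
  show ?case
  proof (cases "triple (goedel p) x y \<in> set l")
    case False
    then have "d = triple (goedel p) x y" using Cons.prems(2) by simp
    then have st: "step (restr A k) (set l) (goedel p) x y"
      using Cons.prems(1) by (simp add: stepd_def)
    show ?thesis
    proof (cases p)
      case (Prec q r)
      show ?thesis
      proof (cases "pr2 x")
        case 0
        then have "evals A q (pr1 x) y" using st IH by (auto simp: step_def Prec)
        then show ?thesis using evals.Prec_0[of A q "pr1 x" y r] 0
          by (metis Prec pair_pr)
      next
        case (Suc n)
        then obtain z where z: "triple (goedel (Prec q r)) (pair (pr1 x) n) z \<in> set l"
          "triple (goedel r) (triple (pr1 x) n z) y \<in> set l"
          using st by (auto simp: step_def Prec)
        show ?thesis using evals.Prec_Suc[OF IH[OF z(1)] IH[OF z(2)]] Suc Prec by (metis pair_pr)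
      qed
    next
      case (Mu q)
      then have "triple (goedel q) (pair x y) 0 \<in> set l"
        "\<forall>m<y. \<exists>z. 0 < z \<and> triple (goedel q) (pair x m) z \<in> set l"
        using st by (auto simp: step_def)
      then show ?thesis unfolding Mu by (intro evals.Mu IH) (meson IH)+
    next
      case (Tuple q r)
      then have "evals A q x (pr1 y)" "evals A r x (pr2 y)" using st IH by (auto simp: step_def)
      from evals.Tuple[OF this] show ?thesis using Tuple by simp
    next
      case (Comp q r)
      then show ?thesis using st IH by (auto simp: step_def intro: evals.Comp)
    next
      case Query
      then show ?thesis using st evals.Query[of A x] by (auto simp: step_def nthc_restr)
    qed (use st in \<open>auto simp: step_def pr1_def pr2_def intro: evals.intros\<close>)
  qed (rule IH)
qed simp

theorem evals_iff_derivation: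
  "evals A p x y \<longleftrightarrow> (\<exists>k l. valid (stepd (restr A k)) l \<and> triple (goedel p) x y \<in> set l)"
  using evals_derivable valid_evals unfolding derivable_def by blast

text \<open>
  The same \<open>R\<close> is decidable in every oracle because all information about \<open>A\<close> that a halting
  computation uses is contained in the string \<open>restr A k\<close>.
\<close>

theorem ce_normal_form:
  assumes "ce A S"
  obtains R where "\<And>B. decidable B R" "\<And>x. x \<in> S \<longleftrightarrow> (\<exists>k. R (pair (restr A k) x))"
proof -
  obtain p where S: "S = {x. halts A p x}" using assms unfolding ce_def by blast
  \<comment> \<open>The length of the oracle string also bounds the code of the derivation and the
    output. This makes \<open>R\<close> decidable and loses nothing, since a longer prefix of the
    oracle may always be taken.\<close>
  define R where "R z \<longleftrightarrow> (\<exists>c\<le>len (pr1 z). \<exists>y\<le>len (pr1 z).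
    valid (stepd (pr1 z)) (list_decode c) \<and> triple (goedel p) (pr2 z) y \<in> elems c)" for z
  have "decidable B R" for B
    unfolding R_def by (intro computable_intros decidable_valid decidable_stepd)
  moreover have "x \<in> S \<longleftrightarrow> (\<exists>k. R (pair (restr A k) x))" for x
  proof
    assume "x \<in> S"
    then obtain y k l where l: "valid (stepd (restr A k)) l" "triple (goedel p) x y \<in> set l"
      unfolding S halts_def using evals_iff_derivation by blast
    define K where "K = max k (max (list_encode l) y)"
    have "valid (stepd (restr A K)) l"
      using valid_stepd_append[OF l(1), of K "[]"] by (simp add: K_def)
    then have "R (pair (restr A K) x)" unfolding R_def
      by (intro exI[of _ "list_encode l"] conjI exI[of _ y]) (auto simp: K_def elems_def l)
    then show "\<exists>k. R (pair (restr A k) x)" ..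
  next
    assume "\<exists>k. R (pair (restr A k) x)"
    then show "x \<in> S"
      unfolding R_def S halts_def elems_def pr_pair using valid_evals by blast
  qed
  ultimately show ?thesis by (rule that)
qed


section \<open>Semidecidable predicates\<close>

definition semidec :: "cantor \<Rightarrow> (nat \<Rightarrow> bool) \<Rightarrow> bool" where
  "semidec A P \<longleftrightarrow> (\<exists>D. decidable A D \<and> (\<forall>x. P x \<longleftrightarrow> (\<exists>w. D (pair x w))))"

named_theorems semidec_intros

lemma semidecI:
  assumes "decidable A (\<lambda>z. D (pr1 z) (pr2 z))" "\<And>x. P x \<longleftrightarrow> (\<exists>w. D x w)"
  shows "semidec A P"
  unfolding semidec_def using assms by (intro exI[of _ "\<lambda>z. D (pr1 z) (pr2 z)"]) simp

lemma semidecD: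
  assumes "semidec A P"
  shows "\<exists>D. decidable A (\<lambda>z. D (pr1 z) (pr2 z)) \<and> (\<forall>x. P x \<longleftrightarrow> (\<exists>w. D x w))"
proof -
  obtain D where D: "decidable A D" "\<And>x. P x \<longleftrightarrow> (\<exists>w. D (pair x w))"
    using assms unfolding semidec_def by blast
  then show ?thesis by (intro exI[of _ "\<lambda>x w. D (pair x w)"]) simp
qed

lemma semidec_compose:
  assumes "semidec A P" "computable A f" shows "semidec A (\<lambda>x. P (f x))"
proof -
  obtain D where D: "decidable A (\<lambda>z. D (pr1 z) (pr2 z))" "\<And>x. P x \<longleftrightarrow> (\<exists>w. D x w)"
    using semidecD[OF assms(1)] by blast
  show ?thesis
    by (rule semidecI[of A "\<lambda>x w. D (f x) w"])
       (intro decidable_compose2[OF D(1)] computable_compose[OF assms(2)] computable_intros, rule D(2))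
qed

lemma semidec_compose2:
  assumes "semidec A (\<lambda>z. P (pr1 z) (pr2 z))" "computable A f" "computable A g"
  shows "semidec A (\<lambda>x. P (f x) (g x))"
  using semidec_compose[OF assms(1) computable_pair[OF assms(2,3)]] by simp

lemma semidec_ex [semidec_intros]:
  assumes "semidec A (\<lambda>z. P (pr1 z) (pr2 z))" shows "semidec A (\<lambda>x. \<exists>y. P x y)"
proof -
  obtain D where D: "decidable A (\<lambda>z. D (pr1 z) (pr2 z))"
    "\<And>z. P (pr1 z) (pr2 z) \<longleftrightarrow> (\<exists>w. D z w)"
    using semidecD[OF assms] by blast
  show ?thesis
  proof (rule semidecI)
    show "decidable A (\<lambda>z. D (pair (pr1 z) (pr1 (pr2 z))) (pr2 (pr2 z)))"
      by (intro decidable_compose2[OF D(1)] computable_intros)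
    show "(\<exists>y. P x y) \<longleftrightarrow> (\<exists>w. D (pair x (pr1 w)) (pr2 w))" for x
      using D(2)[of "pair x y" for y] ex_pair[of "\<lambda>w. D (pair x (pr1 w)) (pr2 w)"] by simp
  qed
qed

lemma semidec_and [semidec_intros]:
  assumes "semidec A P" "semidec A Q" shows "semidec A (\<lambda>x. P x \<and> Q x)"
proof -
  obtain D where D: "decidable A (\<lambda>z. D (pr1 z) (pr2 z))" "\<And>x. P x \<longleftrightarrow> (\<exists>w. D x w)"
    using semidecD[OF assms(1)] by blast
  obtain E where E: "decidable A (\<lambda>z. E (pr1 z) (pr2 z))" "\<And>x. Q x \<longleftrightarrow> (\<exists>w. E x w)"
    using semidecD[OF assms(2)] by blast
  show ?thesis
  proof (rule semidecI)
    show "decidable A (\<lambda>z. D (pr1 z) (pr1 (pr2 z)) \<and> E (pr1 z) (pr2 (pr2 z)))"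
      by (intro decidable_compose2[OF D(1)] decidable_compose2[OF E(1)] computable_intros)
    show "(P x \<and> Q x) \<longleftrightarrow> (\<exists>w. D x (pr1 w) \<and> E x (pr2 w))" for x
      unfolding D(2) E(2) by (subst ex_pair) simp
  qed
qed

lemma semidec_or [semidec_intros]:
  assumes "semidec A P" "semidec A Q" shows "semidec A (\<lambda>x. P x \<or> Q x)"
proof -
  obtain D where D: "decidable A (\<lambda>z. D (pr1 z) (pr2 z))" "\<And>x. P x \<longleftrightarrow> (\<exists>w. D x w)"
    using semidecD[OF assms(1)] by blast
  obtain E where E: "decidable A (\<lambda>z. E (pr1 z) (pr2 z))" "\<And>x. Q x \<longleftrightarrow> (\<exists>w. E x w)"
    using semidecD[OF assms(2)] by blast
  show ?thesis
  proof (rule semidecI)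
    show "decidable A (\<lambda>z. D (pr1 z) (pr2 z) \<or> E (pr1 z) (pr2 z))"
      by (intro D(1) E(1) computable_intros)
    show "(P x \<or> Q x) \<longleftrightarrow> (\<exists>w. D x w \<or> E x w)" for x
      unfolding D(2) E(2) by blast
  qed
qed

text \<open>Bounded collection: finitely many witnesses have a common bound. It merges the witnesses
  under a bounded universal quantifier into one number.\<close>

lemma bounded_choice:
  fixes D :: "nat \<Rightarrow> nat \<Rightarrow> bool"
  shows "(\<forall>i<n. \<exists>w. D i w) \<longleftrightarrow> (\<exists>b. \<forall>i<n. \<exists>w<b. D i w)"
proof
  assume "\<forall>i<n. \<exists>w. D i w"
  then obtain f where f: "\<And>i. i < n \<Longrightarrow> D i (f i)" by metis
  have "f i < Suc (Max (f ` {..<n}))" if "i < n" for i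
    using that by (intro le_imp_less_Suc Max_ge) auto
  then show "\<exists>b. \<forall>i<n. \<exists>w<b. D i w" using f by blast
qed blast

lemma semidec_ball [semidec_intros]:
  assumes "semidec A (\<lambda>z. P (pr1 z) (pr2 z))" "computable A n"
  shows "semidec A (\<lambda>x. \<forall>i<n x. P x i)"
proof -
  obtain D where D: "decidable A (\<lambda>z. D (pr1 z) (pr2 z))"
    "\<And>z. P (pr1 z) (pr2 z) \<longleftrightarrow> (\<exists>w. D z w)"
    using semidecD[OF assms(1)] by blast
  show ?thesis
  proof (rule semidecI)
    show "decidable A (\<lambda>z. \<forall>i<n (pr1 z). \<exists>w<pr2 z. D (pair (pr1 z) i) w)"
      by (intro decidable_compose2[OF D(1)] computable_compose[OF assms(2)] computable_intros)
    show "(\<forall>i<n x. P x i) \<longleftrightarrow> (\<exists>b. \<forall>i<n x. \<exists>w<b. D (pair x i) w)" for x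
      using D(2)[of "pair x i" for i] bounded_choice[of "n x" "\<lambda>i. D (pair x i)"] by simp
  qed
qed

lemma semidec_decidable: "decidable A P \<Longrightarrow> semidec A P"
  by (rule semidecI[of A "\<lambda>x w. P x"]) (rule decidable_compose, assumption, intro computable_intros, simp)

text \<open>Post's theorem: a search for a witness of either side terminates, and the side of the
  first witness found is the answer.\<close>

lemma decidable_post:
  assumes "semidec A P" "semidec A (\<lambda>x. \<not> P x)" shows "decidable A P"
proof -
  obtain D where D: "decidable A (\<lambda>z. D (pr1 z) (pr2 z))" "\<And>x. P x \<longleftrightarrow> (\<exists>w. D x w)"
    using semidecD[OF assms(1)] by blast
  obtain E where E: "decidable A (\<lambda>z. E (pr1 z) (pr2 z))" "\<And>x. \<not> P x \<longleftrightarrow> (\<exists>w. E x w)"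
    using semidecD[OF assms(2)] by blast
  have ex: "\<exists>w. D x w \<or> E x w" for x using D(2) E(2) by blast
  have "decidable A (\<lambda>x. D x (LEAST w. D x w \<or> E x w))"
    by (intro decidable_compose2[OF D(1)] computable_Least computable_intros D(1) E(1) ex)
  moreover have "D x (LEAST w. D x w \<or> E x w) \<longleftrightarrow> P x" for x
    using LeastI_ex[OF ex[of x]] D(2) E(2) by blast
  ultimately show ?thesis by simp
qed

text \<open>In one direction the witness is the length of the oracle prefix in the normal form; in
  the other, \<open>Mu\<close> searches for the witness, and its output is ignored.\<close>

theorem ce_iff_semidec: "ce A {x. P x} \<longleftrightarrow> semidec A P"
proof
  assume "ce A {x. P x}"
  then obtain R where R: "\<And>B. decidable B R" "\<And>x. P x \<longleftrightarrow> (\<exists>k. R (pair (restr A k) x))"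
    by (rule ce_normal_form) auto
  have "decidable A A" using computable_oracle[OF computable_id] .
  then show "semidec A P"
    by (intro semidecI[OF _ R(2)] decidable_compose[OF R(1)] computable_intros)
next
  assume "semidec A P"
  then obtain D where D: "decidable A (\<lambda>z. D (pr1 z) (pr2 z))" "\<And>x. P x \<longleftrightarrow> (\<exists>w. D x w)"
    using semidecD by blast
  have "computable A (\<lambda>z. of_bool (\<not> D (pr1 z) (pr2 z)))" by (intro computable_intros D(1))
  then obtain p where "\<And>z. evals A p z (of_bool (\<not> D (pr1 z) (pr2 z)))"
    unfolding computable_def by blast
  from this[of "pair x n" for x n]
  have p: "\<And>x n. evals A p (pair x n) (of_bool (\<not> D x n))" by simp
  have "halts A (Mu p) x \<longleftrightarrow> P x" for x
  proof
    assume "halts A (Mu p) x"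
    then obtain n where "evals A p (pair x n) 0"
      unfolding halts_def by (auto elim: evals_elims)
    then have "D x n" using evals_det[OF p[of x n]] by fastforce
    then show "P x" unfolding D(2) ..
  next
    assume "P x"
    then have ex: "\<exists>n. D x n" by (simp add: D(2))
    have "evals A (Mu p) x (LEAST n. D x n)"
    proof (rule evals.Mu)
      show "evals A p (pair x (LEAST n. D x n)) 0"
        using p[of x "LEAST n. D x n"] LeastI_ex[OF ex] by simp
      fix m assume "m < (LEAST n. D x n)"
      then have "\<not> D x m" by (rule not_less_Least)
      then show "\<exists>y>0. evals A p (pair x m) y" using p[of x m] by (intro exI[of _ 1]) auto
    qed
    then show "halts A (Mu p) x" unfolding halts_def by blast
  qed
  then have "{x. P x} = {x. halts A (Mu p) x}" by blast
  then show "ce A {x. P x}" unfolding ce_def by blast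
qed


section \<open>The Turing jump\<close>

text \<open>Formation rules for programs, on the level of codes. A derivation by these rules
  certifies that a number is a Goedel number.\<close>

definition gstep :: "nat set \<Rightarrow> nat \<Rightarrow> bool" where
  "gstep r e \<longleftrightarrow> pr1 e \<le> 4 \<and> pr2 e = 0 \<or>
     5 \<le> pr1 e \<and> pr1 e \<le> 7 \<and> pr1 (pr2 e) \<in> r \<and> pr2 (pr2 e) \<in> r \<or>
     pr1 e = 8 \<and> pr2 e \<in> r"

lemma gstep_mono: "gstep r e \<Longrightarrow> r \<subseteq> r' \<Longrightarrow> gstep r' e"
  unfolding gstep_def by blast

lemma gstep_pair:
  "gstep r (pair k u) \<longleftrightarrow> k \<le> 4 \<and> u = 0 \<or> 5 \<le> k \<and> k \<le> 7 \<and> pr1 u \<in> r \<and> pr2 u \<in> r \<or> k = 8 \<and> u \<in> r"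
  by (simp add: gstep_def)

lemmas valid_gstep_append = valid_append[of gstep, OF gstep_mono]

lemma goedel_valid: "\<exists>l. valid gstep l \<and> goedel p \<in> set l"
proof (induction p)
  case (Tuple p q)
  then obtain l l' where "valid gstep l" "goedel p \<in> set l" "valid gstep l'" "goedel q \<in> set l'" by blast
  then show ?case
    by (intro exI[of _ "goedel (Tuple p q) # l @ l'"]) (simp add: gstep_pair valid_gstep_append)
next
  case (Comp p q)
  then obtain l l' where "valid gstep l" "goedel p \<in> set l" "valid gstep l'" "goedel q \<in> set l'" by blast
  then show ?case
    by (intro exI[of _ "goedel (Comp p q) # l @ l'"]) (simp add: gstep_pair valid_gstep_append)
next
  case (Prec p q)
  then obtain l l' where "valid gstep l" "goedel p \<in> set l" "valid gstep l'" "goedel q \<in> set l'" by blast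
  then show ?case
    by (intro exI[of _ "goedel (Prec p q) # l @ l'"]) (simp add: gstep_pair valid_gstep_append)
next
  case (Mu p)
  then obtain l where "valid gstep l" "goedel p \<in> set l" by blast
  then show ?case by (intro exI[of _ "goedel (Mu p) # l"]) (simp add: gstep_pair)
next
  case Zero show ?case by (intro exI[of _ "[goedel Zero]"]) (simp add: gstep_pair)
next
  case Succ show ?case by (intro exI[of _ "[goedel Succ]"]) (simp add: gstep_pair)
next
  case Fst show ?case by (intro exI[of _ "[goedel Fst]"]) (simp add: gstep_pair)
next
  case Snd show ?case by (intro exI[of _ "[goedel Snd]"]) (simp add: gstep_pair)
next
  case Query show ?case by (intro exI[of _ "[goedel Query]"]) (simp add: gstep_pair)
qed

lemma valid_goedel: "valid gstep l \<Longrightarrow> e \<in> set l \<Longrightarrow> \<exists>p. e = goedel p"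
proof (induction l arbitrary: e)
  case (Cons d l)
  then have IH: "\<And>e. e \<in> set l \<Longrightarrow> \<exists>p. e = goedel p" by simp
  show ?case
  proof (cases "e \<in> set l")
    case False
    then have g: "gstep (set l) e" using Cons.prems by auto
    obtain k u where e: "e = pair k u" "u = pair (pr1 u) (pr2 u)" by (metis pair_pr)
    have "k \<le> 4 \<Longrightarrow> k \<in> {0,1,2,3,4}" "5 \<le> k \<Longrightarrow> k \<le> 7 \<Longrightarrow> k \<in> {5,6,7}" by auto
    with g[unfolded e(1) gstep_pair]
    consider "k \<in> {0,1,2,3,4}" "u = 0" | "k \<in> {5,6,7}" "pr1 u \<in> set l" "pr2 u \<in> set l"
      | "k = 8" "u \<in> set l" by blast
    then show ?thesis
    proof cases
      case 1
      then show ?thesis unfolding e(1)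
        by (elim insertE emptyE) (metis goedel.simps(1-5) numeral_One One_nat_def)+
    next
      case 2
      then obtain p q where "pr1 u = goedel p" "pr2 u = goedel q" using IH by blast
      then have "u = pair (goedel p) (goedel q)" using e(2) by simp
      then show ?thesis using 2(1) unfolding e(1)
        by (elim insertE emptyE) (metis goedel.simps(6-8))+
    next
      case 3
      then obtain p where "u = goedel p" using IH by blast
      then show ?thesis using 3(1) unfolding e(1) by (metis goedel.simps(9))
    qed
  qed (rule IH)
qed simp

lemma goedel_inj: "goedel p = goedel q \<Longrightarrow> p = q"
proof (induction p arbitrary: q)
  case Zero then show ?case by (cases q) auto
next
  case Succ then show ?case by (cases q) auto
next
  case Fst then show ?case by (cases q) auto
next
  case Snd then show ?case by (cases q) auto
next
  case Query then show ?case by (cases q) auto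
next
  case (Tuple p1 p2) then show ?case by (cases q) auto
next
  case (Comp p1 p2) then show ?case by (cases q) auto
next
  case (Prec p1 p2) then show ?case by (cases q) auto
next
  case (Mu p) then show ?case by (cases q) auto
qed

lemma decidable_valid_gstep:
  assumes "computable A g" shows "decidable A (\<lambda>x. valid gstep (list_decode (g x)))"
proof -
  have "decidable A (\<lambda>z. gstep (elems (pr1 (pr2 z))) (pr2 (pr2 z)))"
    unfolding gstep_def by (intro computable_intros)
  from decidable_valid[of A "\<lambda>_. gstep", OF this assms assms] show ?thesis .
qed

lemmas decidable_valid_stepd = decidable_valid[of _ stepd, OF decidable_stepd]

text \<open>The certificate by \<open>gstep\<close> has to accompany the halting derivation, because
  \<open>step\<close> also accepts numbers such as \<open>pair 0 1\<close> that code no program, and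
  these are excluded from the jump.\<close>

lemma semidec_jump: "semidec B (jump B)"
proof -
  have "jump B e \<longleftrightarrow>
      (\<exists>c. valid gstep (list_decode c) \<and> e \<in> elems c) \<and>
      (\<exists>y k c. valid (stepd (restr B k)) (list_decode c) \<and> triple e e y \<in> elems c)" (is "_ \<longleftrightarrow> ?C e \<and> ?E e") for e
  proof
    assume "jump B e"
    then obtain p y where p: "e = goedel p" "evals B p e y" unfolding jump_def halts_def by blast
    obtain l where "valid gstep l" "e \<in> set l" using goedel_valid p(1) by blast
    then have "?C e" by (intro exI[of _ "list_encode l"]) (simp add: elems_def)
    moreover obtain k l where "valid (stepd (restr B k)) l" "triple e e y \<in> set l"
      using p evals_iff_derivation by metis
    then have "?E e"
      by (intro exI[of _ y] exI[of _ k] exI[of _ "list_encode l"]) (simp add: elems_def)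
    ultimately show "?C e \<and> ?E e" ..
  next
    assume "?C e \<and> ?E e"
    moreover from this obtain p where "e = goedel p" using valid_goedel unfolding elems_def by blast
    ultimately show "jump B e"
      unfolding jump_def halts_def elems_def using valid_evals by blast
  qed
  moreover have "semidec B ?C"
    by (intro semidec_intros semidec_decidable decidable_valid_gstep computable_intros)
  moreover have "semidec B ?E"
    by (intro semidec_ex semidec_decidable decidable_and decidable_valid_stepd computable_intros)
  ultimately show ?thesis using semidec_and by presburger
qed

fun const_prog :: "nat \<Rightarrow> prog" where
  "const_prog 0 = Zero"
| "const_prog (Suc n) = Comp Succ (const_prog n)"

lemma evals_const_prog: "evals A (const_prog n) x y \<longleftrightarrow> y = n"
proof -
  have "evals A (const_prog n) x n"
    by (induction n) (auto intro: evals.Zero evals.Comp evals.Succ)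
  then show ?thesis using evals_det by blast
qed

text \<open>The jump only tells whether a program halts on its own index. So the question about
  \<open>x\<close> is put to the program that discards its input and runs \<open>p\<close> on
  \<open>x\<close>; its index \<open>g x\<close> is computable from \<open>x\<close>.\<close>

lemma decidable_jump:
  assumes "semidec B P" shows "decidable (jump B) P"
proof -
  obtain p where p: "{x. P x} = {x. halts B p x}"
    using assms unfolding ce_iff_semidec[symmetric] ce_def by blast
  define g where "g x = goedel (Comp p (const_prog x))" for x
  have "goedel (const_prog x) = rec_nat (pair 0 0) (\<lambda>_ y. pair 6 (pair (goedel Succ) y)) x" for x
    by (induction x) simp_all
  then have "g = (\<lambda>x. pair 6 (pair (goedel p) (rec_nat (pair 0 0) (\<lambda>_ y. pair 6 (pair (goedel Succ) y)) x)))"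
    by (simp add: g_def fun_eq_iff)
  moreover have "computable (jump B) \<dots>" by (intro computable_intros computable_rec_nat)
  ultimately have g: "computable (jump B) g" by simp
  have "jump B (g x) \<longleftrightarrow> P x" for x
  proof -
    have "jump B (g x) \<longleftrightarrow> halts B (Comp p (const_prog x)) (g x)"
      unfolding jump_def g_def using goedel_inj by blast
    also have "\<dots> \<longleftrightarrow> halts B p x"
    proof
      assume "halts B (Comp p (const_prog x)) (g x)"
      then obtain y where "evals B (Comp p (const_prog x)) (g x) y" unfolding halts_def ..
      then show "halts B p x" by (elim evals_elims) (auto simp: evals_const_prog halts_def)
    next
      assume "halts B p x"
      then show "halts B (Comp p (const_prog x)) (g x)"
        unfolding halts_def using evals.Comp evals_const_prog by metis
    qed
    finally show ?thesis using p by blast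
  qed
  then show ?thesis using computable_oracle[OF g] by simp
qed

lemma restr_eqI: "(\<And>i. i < len c \<Longrightarrow> nthc c i = of_bool (X i)) \<Longrightarrow> c = restr X (len c)"
proof -
  assume *: "\<And>i. i < len c \<Longrightarrow> nthc c i = of_bool (X i)"
  have "c = takec (len c) c" by (simp add: takec_def len_def)
  also have "\<dots> = restr X (len c)"
    unfolding takec_eq using *
    by (auto simp: restr_def str_code_def intro!: arg_cong[of _ _ list_encode])
  finally show ?thesis .
qed

text \<open>A wrong prefix is recognised with finitely many answers of the jump. Positive answers
  are confirmed by a witness and negative ones by the absence of any, so being wrong is an
  exists-forall statement over \<open>B\<close>; its negation is the stated form.\<close>

lemma prefix_Pi2:
  assumes "decidable (jump B) A"
  obtains Q where "semidec B (\<lambda>z. Q (pr1 z) (pr2 z))"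
    "\<And>\<tau>. \<tau> = restr A (len \<tau>) \<longleftrightarrow> (\<forall>z. Q z \<tau>)"
proof -
  have "semidec (jump B) (\<lambda>\<tau>. \<tau> \<noteq> restr A (len \<tau>))"
    by (intro semidec_decidable computable_intros assms)
  then have "ce (jump B) {\<tau>. \<tau> \<noteq> restr A (len \<tau>)}" unfolding ce_iff_semidec .
  then obtain R where R: "\<And>C. decidable C R"
    "\<And>\<tau>. \<tau> \<noteq> restr A (len \<tau>) \<longleftrightarrow> (\<exists>k. R (pair (restr (jump B) k) \<tau>))"
    by (rule ce_normal_form) auto
  obtain D where D: "decidable B (\<lambda>z. D (pr1 z) (pr2 z))" "\<And>i. jump B i \<longleftrightarrow> (\<exists>w. D i w)"
    using semidecD[OF semidec_jump[of B]] by blast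
  \<comment> \<open>\<open>\<rho>\<close> is a guessed prefix of the jump, \<open>v\<close> bounds
    the witnesses for its ones, and \<open>u\<close> is a possible witness against its zeros. If
    \<open>N\<close> holds for all \<open>u\<close>, then the guess is right.\<close>
  define N where "N \<rho> v \<tau> u \<longleftrightarrow> is_str \<rho> \<and> R (pair \<rho> \<tau>) \<and>
    (\<forall>i<len \<rho>. nthc \<rho> i = 1 \<longrightarrow> (\<exists>w<v. D i w)) \<and>
    (\<forall>i<len \<rho>. nthc \<rho> i = 0 \<longrightarrow> \<not> D i u)" for \<rho> v \<tau> u
  have "semidec B (\<lambda>z. \<exists>u. \<not> N (pr1 (pr1 z)) (pr2 (pr1 z)) (pr2 z) u)"
    unfolding N_def
    by (intro semidec_ex semidec_decidable computable_intros decidable_compose[OF R(1)] decidable_compose2[OF D(1)])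
  moreover have "\<tau> = restr A (len \<tau>) \<longleftrightarrow> (\<forall>z. \<exists>u. \<not> N (pr1 z) (pr2 z) \<tau> u)" for \<tau>
  proof -
    have "(\<exists>k. R (pair (restr (jump B) k) \<tau>)) \<longleftrightarrow> (\<exists>\<rho> v. \<forall>u. N \<rho> v \<tau> u)"
    proof
      assume "\<exists>k. R (pair (restr (jump B) k) \<tau>)"
      then obtain k where k: "R (pair (restr (jump B) k) \<tau>)" ..
      have "\<forall>i<k. \<exists>w. jump B i \<longrightarrow> D i w" using D(2) by blast
      from iffD1[OF bounded_choice this]
      obtain v where "\<forall>i<k. \<exists>w<v. jump B i \<longrightarrow> D i w" ..
      then have "N (restr (jump B) k) v \<tau> u" for u
        unfolding N_def using k D(2) by (auto simp: nthc_restr)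
      then show "\<exists>\<rho> v. \<forall>u. N \<rho> v \<tau> u" by blast
    next
      assume "\<exists>\<rho> v. \<forall>u. N \<rho> v \<tau> u"
      then obtain \<rho> v where N: "\<And>u. N \<rho> v \<tau> u" by blast
      have "nthc \<rho> i = of_bool (jump B i)" if "i < len \<rho>" for i
      proof -
        have "nthc \<rho> i \<le> 1" using N[of 0] that unfolding N_def is_str_def by blast
        then consider "nthc \<rho> i = 1" | "nthc \<rho> i = 0" by linarith
        then show ?thesis
        proof cases
          case 1 then show ?thesis using N[of 0] that D(2) unfolding N_def by auto
        next
          case 2
          then have "\<not> D i u" for u using N[of u] that unfolding N_def by blast
          then show ?thesis using 2 D(2) by auto
        qed
      qed
      then have "\<rho> = restr (jump B) (len \<rho>)" by (rule restr_eqI)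
      moreover have "R (pair \<rho> \<tau>)" using N[of 0] unfolding N_def by blast
      ultimately show "\<exists>k. R (pair (restr (jump B) k) \<tau>)" by metis
    qed
    then show ?thesis
      unfolding all_pair[of "\<lambda>z. \<exists>u. \<not> N (pr1 z) (pr2 z) \<tau> u"] pr_pair
      using R(2)[of \<tau>] by blast
  qed
  ultimately show ?thesis by (rule that)
qed


section \<open>Effectively open classes\<close>

lemma generated_class_eq: "generated_class W = {X. \<exists>k. restr X k \<in> str_code ` W}"
proof -
  have "k = length \<sigma>" if "restr X k = str_code \<sigma>" for X k \<sigma>
    using arg_cong[OF that, of len] by simp
  then have "(\<exists>\<sigma>\<in>W. str_code \<sigma> = restr X (length \<sigma>)) \<longleftrightarrow> (\<exists>k. restr X k \<in> str_code ` W)" for X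
    unfolding image_iff by metis
  then show ?thesis unfolding generated_class_def initial_segment_iff by (rule Collect_cong)
qed

lemma restr_mem_iff: "restr X k \<in> str_code ` {\<sigma>. P (str_code \<sigma>)} \<longleftrightarrow> P (restr X k)"
  by (auto simp: restr_def)

text \<open>\<open>P\<close> may also hold of numbers that code no string: no prefix has such a
  code, so they do not affect the class and can be filtered out.\<close>

lemma sigma1_iff: "sigma1 A U \<longleftrightarrow> (\<exists>P. semidec A P \<and> U = {X. \<exists>k. P (restr X k)})"
proof
  assume "sigma1 A U"
  then obtain W where W: "ce A (str_code ` W)" "U = generated_class W" unfolding sigma1_def by blast
  have "U = {X. \<exists>k. restr X k \<in> str_code ` W}"
    unfolding W(2) by (rule generated_class_eq)
  then show "\<exists>P. semidec A P \<and> U = {X. \<exists>k. P (restr X k)}"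
    using W(1) by (intro exI[of _ "\<lambda>x. x \<in> str_code ` W"]) (simp flip: ce_iff_semidec)
next
  assume "\<exists>P. semidec A P \<and> U = {X. \<exists>k. P (restr X k)}"
  then obtain P where P: "semidec A P" "U = {X. \<exists>k. P (restr X k)}" by blast
  have "str_code ` {\<sigma>. P (str_code \<sigma>)} = {c. is_str c \<and> P c}" unfolding is_str_iff by auto
  moreover have "semidec A (\<lambda>c. is_str c \<and> P c)"
    by (intro semidec_intros P(1) semidec_decidable computable_intros)
  moreover have "U = generated_class {\<sigma>. P (str_code \<sigma>)}"
    unfolding P(2) generated_class_eq restr_mem_iff ..
  ultimately show "sigma1 A U" unfolding sigma1_def by (metis ce_iff_semidec)
qed

lemma uniformly_sigma1_iff:
  "uniformly_sigma1 A U \<longleftrightarrow> (\<exists>P. semidec A (\<lambda>z. P (pr1 z) (pr2 z)) \<and> (\<forall>n. U n = {X. \<exists>k. P n (restr X k)}))"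
proof
  assume "uniformly_sigma1 A U"
  then obtain W where W: "ce A {pair n (str_code \<sigma>) | n \<sigma>. \<sigma> \<in> W n}" "\<And>n. U n = generated_class (W n)"
    unfolding uniformly_sigma1_def by blast
  have "{pair n (str_code \<sigma>) | n \<sigma>. \<sigma> \<in> W n} = {z. pr2 z \<in> str_code ` W (pr1 z)}"
    by (auto simp: image_iff) (metis pair_pr)
  then have "semidec A (\<lambda>z. pr2 z \<in> str_code ` W (pr1 z))"
    using W(1) by (simp flip: ce_iff_semidec)
  moreover have "U n = {X. \<exists>k. restr X k \<in> str_code ` W n}" for n
    unfolding W(2) by (rule generated_class_eq)
  ultimately show "\<exists>P. semidec A (\<lambda>z. P (pr1 z) (pr2 z)) \<and> (\<forall>n. U n = {X. \<exists>k. P n (restr X k)})"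
    by (intro exI[of _ "\<lambda>n x. x \<in> str_code ` W n"]) simp
next
  assume "\<exists>P. semidec A (\<lambda>z. P (pr1 z) (pr2 z)) \<and> (\<forall>n. U n = {X. \<exists>k. P n (restr X k)})"
  then obtain P where P: "semidec A (\<lambda>z. P (pr1 z) (pr2 z))" "\<And>n. U n = {X. \<exists>k. P n (restr X k)}" by blast
  have "{pair n (str_code \<sigma>) | n \<sigma>. \<sigma> \<in> {\<sigma>. P n (str_code \<sigma>)}} = {z. is_str (pr2 z) \<and> P (pr1 z) (pr2 z)}"
    unfolding is_str_iff by auto (metis pair_pr)
  moreover have "semidec A (\<lambda>z. is_str (pr2 z) \<and> P (pr1 z) (pr2 z))"
    by (intro semidec_and P(1) semidec_decidable computable_intros)
  moreover have "U n = generated_class {\<sigma>. P n (str_code \<sigma>)}" for n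
    unfolding P(2) generated_class_eq restr_mem_iff ..
  ultimately show "uniformly_sigma1 A U" unfolding uniformly_sigma1_def
    by (intro exI[of _ "\<lambda>n. {\<sigma>. P n (str_code \<sigma>)}"]) (simp add: ce_iff_semidec)
qed


section \<open>Measure on Cantor space\<close>

interpretation flips: product_prob_space "\<lambda>_. measure_pmf (bernoulli_pmf (1/2))" "UNIV :: nat set"
  by unfold_locales

lemma prob_space_fair_coin: "prob_space fair_coin"
  unfolding fair_coin_def by (rule flips.P.prob_space_axioms)

interpretation coin: prob_space fair_coin
  by (rule prob_space_fair_coin)

lemma space_fair_coin [simp]: "space fair_coin = UNIV"
  by (simp add: fair_coin_def space_PiM)

lemma measurable_coordinate [measurable]: "(\<lambda>X. X i) \<in> measurable fair_coin (count_space UNIV)"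
proof -
  have "(\<lambda>X. X i) \<in> measurable fair_coin (measure_pmf (bernoulli_pmf (1/2)))"
    unfolding fair_coin_def by measurable
  then show ?thesis by simp
qed

lemma prob_cylinder:
  assumes "finite T"
  shows "measure fair_coin {X. \<forall>t\<in>T. X t = b t} = (1/2) ^ card T"
proof -
  have "emeasure fair_coin {X \<in> space fair_coin. \<forall>t\<in>T. X t \<in> {b t}} =
      (\<Prod>t\<in>T. emeasure (measure_pmf (bernoulli_pmf (1/2))) {b t})"
    unfolding fair_coin_def by (rule flips.emeasure_PiM_Collect) (auto simp: assms)
  also have "\<dots> = (\<Prod>t\<in>T. ennreal (1/2))"
    by (intro prod.cong refl) (simp add: emeasure_pmf_single)
  also have "\<dots> = ennreal ((1/2) ^ card T)"
    by (subst prod_constant, subst ennreal_power) auto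
  finally show ?thesis by (simp add: measure_def)
qed

lemma restr_eq_code_iff: "restr X (len c) = c \<longleftrightarrow> (\<forall>i<len c. nthc c i = of_bool (X i))"
proof
  assume "restr X (len c) = c"
  then have "nthc c i = nthc (restr X (len c)) i" for i by simp
  then show "\<forall>i<len c. nthc c i = of_bool (X i)" by (simp add: nthc_restr)
qed (metis restr_eqI)

lemma restr_eq_iff_len: "restr X k = c \<longleftrightarrow> k = len c \<and> restr X (len c) = c"
  using len_restr by metis

lemma measurable_restr [measurable]: "(\<lambda>X. restr X k) \<in> measurable fair_coin (count_space UNIV)"
proof (subst measurable_count_space_eq2_countable, safe)
  fix c
  have "{X \<in> space fair_coin. k = len c \<and> (\<forall>i\<in>{..<len c}. nthc c i = of_bool (X i))} \<in> sets fair_coin"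
    by measurable
  moreover have "(\<lambda>X. restr X k) -` {c} \<inter> space fair_coin =
      {X \<in> space fair_coin. k = len c \<and> (\<forall>i\<in>{..<len c}. nthc c i = of_bool (X i))}"
    by (auto simp: restr_eq_iff_len[of _ k] restr_eq_code_iff nthc_restr)
  ultimately show "(\<lambda>X. restr X k) -` {c} \<inter> space fair_coin \<in> sets fair_coin" by simp
qed simp_all

lemma sets_open_class [measurable]: "{X. \<exists>k. P k (restr X k)} \<in> sets fair_coin"
proof -
  have "{X \<in> space fair_coin. \<exists>k. P k (restr X k)} \<in> sets fair_coin" by measurable
  then show ?thesis by simp
qed

lemma sigma1_sets: "sigma1 A U \<Longrightarrow> U \<in> sets fair_coin"
  unfolding sigma1_iff by auto

lemma pi1_sets: "pi1 A P \<Longrightarrow> P \<in> sets fair_coin"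
  unfolding pi1_def using sigma1_sets[of A "- P"] sets.Diff[OF sets.top, of "- P" fair_coin]
  by (simp add: Diff_eq)

lemma prob_restr_eq:
  assumes "is_str c" shows "measure fair_coin {X. restr X (len c) = c} = (1/2) ^ len c"
proof -
  have "nthc c i = of_bool b \<longleftrightarrow> b = (nthc c i = 1)" if "i < len c" for i b
    using assms that by (cases b) (auto simp: is_str_def le_Suc_eq)
  then have "{X. restr X (len c) = c} = {X. \<forall>i\<in>{..<len c}. X i = (nthc c i = 1)}"
    unfolding restr_eq_code_iff by auto
  then show ?thesis by (simp add: prob_cylinder)
qed

lemma prob_restr_le: "measure fair_coin {X. restr X (len c) = c} \<le> (1/2) ^ len c"
proof (cases "is_str c")
  case False
  then have "{X. restr X (len c) = c} = {}" by (metis (mono_tags) Collect_empty_eq is_str_restr)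
  then show ?thesis by simp
qed (simp add: prob_restr_eq)

lemma prob_restr_mem:
  assumes "finite S" "\<And>c. c \<in> S \<Longrightarrow> is_str c \<and> len c = L"
  shows "measure fair_coin {X. restr X L \<in> S} = card S * (1/2) ^ L"
  using assms
proof (induction S)
  case (insert c S)
  have "{X. restr X L \<in> insert c S} = {X. restr X L = c} \<union> {X. restr X L \<in> S}" by auto
  moreover have "{X. restr X L = c} \<in> sets fair_coin" "{X. restr X L \<in> S} \<in> sets fair_coin"
  proof -
    have "{X \<in> space fair_coin. restr X L = c} \<in> sets fair_coin"
      "{X \<in> space fair_coin. restr X L \<in> S} \<in> sets fair_coin" by measurable
    then show "{X. restr X L = c} \<in> sets fair_coin" "{X. restr X L \<in> S} \<in> sets fair_coin" by simp_all
  qed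
  moreover have "measure fair_coin {X. restr X L = c} = (1/2) ^ L"
    using prob_restr_eq[of c] insert.prems[of c] by simp
  ultimately show ?case
    using insert by (simp add: coin.finite_measure_Union Collect_conj_eq[symmetric] disjoint_iff algebra_simps)
qed simp

lemma finite_strings: "finite {c. is_str c \<and> len c = L}"
proof (rule finite_subset)
  show "{c. is_str c \<and> len c = L} \<subseteq> str_code ` {\<sigma>. set \<sigma> \<subseteq> UNIV \<and> length \<sigma> = L}"
    unfolding is_str_iff by auto
qed (intro finite_imageI finite_lists_length_eq finite)


section \<open>Measure of effectively open classes\<close>

text \<open>The measure is approximated from below by the points accepted through a prefix of length
  at most \<open>L\<close>. These form a union of cylinders of length \<open>L\<close>, so a list of
  more than \<open>a * 2 ^ L / 2 ^ b\<close> distinct strings, each with an accepted prefix, is a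
  finite witness, checked in integer arithmetic.\<close>

theorem semidec_measure_gt:
  assumes P: "semidec B (\<lambda>z. P (pr1 z) (pr2 z))"
  shows "semidec B (\<lambda>z. real (pr1 (pr2 z)) / 2 ^ pr2 (pr2 z) < measure fair_coin {X. \<exists>k. P (pr1 z) (restr X k)})"
proof -
  define Q where "Q i a b L l \<longleftrightarrow> distinct (list_decode l) \<and> a * 2 ^ L < len l * 2 ^ b \<and>
    (\<forall>m<len l. is_str (nthc l m) \<and> len (nthc l m) = L \<and> (\<exists>k. k \<le> L \<and> P i (takec k (nthc l m))))" for i a b L l
  have "semidec B (\<lambda>z. \<exists>L l. Q (pr1 z) (pr1 (pr2 z)) (pr2 (pr2 z)) L l)"
    unfolding Q_def
    by (intro semidec_ex semidec_and semidec_ball semidec_compose2[OF P] computable_intros | rule semidec_decidable)+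
  moreover have "real a / 2 ^ b < measure fair_coin {X. \<exists>k. P i (restr X k)} \<longleftrightarrow> (\<exists>L l. Q i a b L l)" for i a b
  proof
    let ?K = "\<lambda>L. {X. \<exists>k\<le>L. P i (restr X k)}"
    assume gt: "real a / 2 ^ b < measure fair_coin {X. \<exists>k. P i (restr X k)}"
    have sets: "?K L \<in> sets fair_coin" for L
    proof -
      have "{X \<in> space fair_coin. \<exists>k\<le>L. P i (restr X k)} \<in> sets fair_coin" by measurable
      then show ?thesis by simp
    qed
    have "(\<lambda>L. measure fair_coin (?K L)) \<longlonglongrightarrow> measure fair_coin (\<Union>L. ?K L)"
      by (rule coin.finite_Lim_measure_incseq) (use sets in \<open>auto simp: incseq_def intro: order_trans\<close>)
    also have "(\<Union>L. ?K L) = {X. \<exists>k. P i (restr X k)}" by auto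
    finally have "\<forall>\<^sub>F L in sequentially. real a / 2 ^ b < measure fair_coin (?K L)"
      using gt by (rule order_tendstoD)
    then obtain L where L: "real a / 2 ^ b < measure fair_coin (?K L)"
      by (auto simp: eventually_sequentially)
    define S where "S = {c. is_str c \<and> len c = L \<and> (\<exists>k\<le>L. P i (takec k c))}"
    have fin: "finite S" by (rule finite_subset[OF _ finite_strings[of L]]) (auto simp: S_def)
    have "?K L = {X. restr X L \<in> S}"
      unfolding S_def by (auto simp: min_def)
    then have "measure fair_coin (?K L) = card S * (1/2) ^ L"
      using prob_restr_mem[OF fin, of L] by (auto simp: S_def)
    with L have "real a / 2 ^ b < card S * (1/2) ^ L" by (simp only:)
    then have "real a * 2 ^ L < card S * 2 ^ b"
      by (simp add: field_simps power_divide)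
    then have "a * 2 ^ L < card S * 2 ^ b"
      using of_nat_less_iff[where 'a=real, of "a * 2 ^ L" "card S * 2 ^ b"] by simp
    moreover obtain xs where xs: "set xs = S" "distinct xs" using fin finite_distinct_list by blast
    moreover have "len (list_encode xs) = card S"
      using distinct_card[OF xs(2)] by (simp add: len_def xs(1))
    moreover have "nthc (list_encode xs) m \<in> S" if "m < len (list_encode xs)" for m
      using that xs(1) by (auto simp: len_def nthc_def)
    ultimately have "Q i a b L (list_encode xs)"
      unfolding Q_def by (simp add: S_def)
    then show "\<exists>L l. Q i a b L l" by blast
  next
    assume "\<exists>L l. Q i a b L l"
    then obtain L l where Q: "Q i a b L l" by blast
    have S: "is_str c \<and> len c = L \<and> (\<exists>k\<le>L. P i (takec k c))" if "c \<in> elems l" for c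
      using Q that unfolding Q_def elems_iff by blast
    have "card (elems l) = len l" using Q unfolding Q_def elems_def len_def by (simp add: distinct_card)
    then have "a * 2 ^ L < card (elems l) * 2 ^ b" using Q unfolding Q_def by simp
    then have "real a * 2 ^ L < card (elems l) * 2 ^ b"
      using of_nat_less_iff[where 'a=real, of "a * 2 ^ L" "card (elems l) * 2 ^ b"] by simp
    then have "real a / 2 ^ b < card (elems l) * (1/2) ^ L"
      by (simp add: field_simps power_divide)
    also have "\<dots> = measure fair_coin {X. restr X L \<in> elems l}"
      using S by (intro prob_restr_mem[symmetric]) (auto simp: elems_def)
    also have "\<dots> \<le> measure fair_coin {X. \<exists>k. P i (restr X k)}"
      using S by (intro coin.finite_measure_mono sets_open_class) fastforce
    finally show "real a / 2 ^ b < measure fair_coin {X. \<exists>k. P i (restr X k)}" .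
  qed
  ultimately show ?thesis by simp
qed


section \<open>Sets of finite weight\<close>

definition light :: "(nat \<Rightarrow> nat) \<Rightarrow> nat set \<Rightarrow> bool" where
  "light w J \<longleftrightarrow> summable (\<lambda>i. if i \<in> J then (1/2) ^ w i else 0 :: real)"

lemma light_Un: "light w J \<Longrightarrow> light w J' \<Longrightarrow> light w (J \<union> J')"
  unfolding light_def by (drule (1) summable_add, erule summable_comparison_test[rotated]) auto

lemma light_finite: "finite J \<Longrightarrow> light w J"
  unfolding light_def by (rule summable_finite) auto

lemma lightI:
  assumes "\<And>n. (\<Sum>i\<in>J \<inter> {..<n}. (1/2) ^ w i) \<le> (C::real)"
  shows "light w J"
  unfolding light_def
proof (rule summableI_nonneg_bounded)
  show "(\<Sum>i<n. if i \<in> J then (1/2) ^ w i else 0) \<le> C" for n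
    using assms[of n] by (simp add: sum.inter_restrict[symmetric] Int_commute)
qed auto

section \<open>Independent clopen blocks\<close>

definition block :: "(nat \<Rightarrow> nat) \<Rightarrow> nat \<Rightarrow> cantor set" where
  "block w i = {X. \<forall>j<w i. X (pair i j)}"

lemma sets_block [measurable]: "block w i \<in> sets fair_coin"
proof -
  have "{X \<in> space fair_coin. \<forall>j\<in>{..<w i}. X (pair i j)} \<in> sets fair_coin" by measurable
  then show ?thesis by (simp add: block_def Ball_def)
qed

text \<open>The set \<open>T\<close> of coordinates fixed to one is there for the induction:
  avoiding one more block means subtracting the same event with the coordinates of that block added
  to \<open>T\<close>.\<close>

lemma prob_blocks:
  assumes "finite K" "finite T" "\<And>i j. i \<in> K \<Longrightarrow> pair i j \<notin> T"
  shows "measure fair_coin {X. (\<forall>t\<in>T. X t) \<and> (\<forall>i\<in>K. X \<notin> block w i)} =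
    (1/2) ^ card T * (\<Prod>i\<in>K. 1 - (1/2) ^ w i)"
  using assms
proof (induction K arbitrary: T)
  case empty
  then show ?case using prob_cylinder[of T "\<lambda>_. True"] by simp
next
  case (insert i K)
  have sets: "{X. (\<forall>t\<in>T. X t) \<and> (\<forall>i\<in>K. X \<notin> block w i)} \<in> sets fair_coin" if "finite T" "finite K" for T K
  proof -
    have "{X \<in> space fair_coin. (\<forall>t\<in>T. X t) \<and> (\<forall>i\<in>K. X \<notin> block w i)} \<in> sets fair_coin"
      using that by measurable
    then show ?thesis by simp
  qed
  define T' where "T' = T \<union> (\<lambda>j. pair i j) ` {..<w i}"
  have T': "finite T'" using insert.prems(1) by (simp add: T'_def)
  have "card T' = card T + card ((\<lambda>j. pair i j) ` {..<w i})"
    unfolding T'_def using insert.prems by (intro card_Un_disjoint) auto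
  also have "card ((\<lambda>j. pair i j) ` {..<w i}) = w i"
    by (subst card_image) (auto simp: inj_on_def)
  finally have card: "card T' = card T + w i" .
  let ?S = "\<lambda>T K. {X. (\<forall>t\<in>T. X t) \<and> (\<forall>i\<in>K. X \<notin> block w i)}"
  have "?S T (insert i K) = ?S T K - ?S T' K"
    unfolding T'_def block_def by (auto simp: ball_Un)
  moreover have "?S T' K \<subseteq> ?S T K" unfolding T'_def by auto
  ultimately have "measure fair_coin (?S T (insert i K)) = measure fair_coin (?S T K) - measure fair_coin (?S T' K)"
    using sets insert.prems T' insert.hyps by (simp add: coin.finite_measure_Diff)
  also have "measure fair_coin (?S T K) = (1/2) ^ card T * (\<Prod>i\<in>K. 1 - (1/2) ^ w i)"
    using insert.prems by (intro insert.IH) auto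
  also have "measure fair_coin (?S T' K) = (1/2) ^ card T' * (\<Prod>i\<in>K. 1 - (1/2) ^ w i)"
    using T' insert.prems insert.hyps by (intro insert.IH) (auto simp: T'_def)
  finally show ?case using insert.hyps by (simp add: card power_add algebra_simps)
qed

lemma prob_block: "measure fair_coin (block w i) = (1/2) ^ w i"
proof -
  have "measure fair_coin (- block w i) = 1 - (1/2) ^ w i"
    using prob_blocks[of "{i}" "{}" w] by (simp add: Compl_eq)
  moreover have "measure fair_coin (- block w i) = 1 - measure fair_coin (block w i)"
    using coin.prob_compl[OF sets_block[of w i]] by (simp add: Compl_eq_Diff_UNIV)
  ultimately show ?thesis by simp
qed

text \<open>
  The blocks are independent, so \<open>1 - x \<le> exp (- x)\<close> bounds the weight by the measure of the
  complement of the union.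
\<close>

lemma light_if_blocks_small:
  assumes "measure fair_coin (\<Union>i\<in>J. block w i) < 1"
  shows "light w J"
proof (rule lightI)
  define \<delta> where "\<delta> = 1 - measure fair_coin (\<Union>i\<in>J. block w i)"
  have \<delta>: "\<delta> > 0" using assms by (simp add: \<delta>_def)
  fix n
  let ?K = "J \<inter> {..<n}"
  have sets: "(\<Union>i\<in>J. block w i) \<in> sets fair_coin" "(\<Union>i\<in>?K. block w i) \<in> sets fair_coin"
    by (auto intro!: sets.countable_UN')
  have "\<delta> \<le> 1 - measure fair_coin (\<Union>i\<in>?K. block w i)"
    unfolding \<delta>_def using sets by (simp, intro coin.finite_measure_mono) auto
  also have "\<dots> = measure fair_coin {X. \<forall>i\<in>?K. X \<notin> block w i}"
  proof -
    have "UNIV - (\<Union>i\<in>?K. block w i) = {X. \<forall>i\<in>?K. X \<notin> block w i}" by auto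
    then show ?thesis using coin.prob_compl[OF sets(2)] by (simp only: space_fair_coin)
  qed
  also have "\<dots> = (\<Prod>i\<in>?K. 1 - (1/2) ^ w i)"
    using prob_blocks[of ?K "{}" w] by simp
  also have "\<dots> \<le> (\<Prod>i\<in>?K. exp (- ((1/2) ^ w i)))"
  proof (intro prod_mono conjI)
    fix i
    show "0 \<le> 1 - (1/2 :: real) ^ w i" by (simp add: power_le_one)
    show "1 - (1/2 :: real) ^ w i \<le> exp (- ((1/2) ^ w i))"
      using exp_ge_add_one_self[of "- ((1/2 :: real) ^ w i)"] by simp
  qed
  also have "\<dots> = exp (- (\<Sum>i\<in>?K. (1/2) ^ w i))"
    by (simp add: exp_sum sum_negf[symmetric])
  finally have "ln \<delta> \<le> - (\<Sum>i\<in>?K. (1/2) ^ w i)" using \<delta> by (metis ln_exp ln_mono)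
  then show "(\<Sum>i\<in>?K. (1/2) ^ w i) \<le> - ln \<delta>" by simp
qed


section \<open>Solovay tests\<close>

text \<open>Markov's inequality for \<open>u n\<close>, the number of indices of \<open>J\<close>
  below \<open>n\<close> whose set contains the point; its expectation is at most the total weight.
  The events increase with \<open>n\<close>, so the bound passes to the limit.\<close>

lemma prob_many_le:
  assumes D [measurable]: "\<And>i. D i \<in> sets fair_coin"
    and le: "\<And>i. measure fair_coin (D i) \<le> (1/2) ^ w i" and w: "light w J" and M: "M > 0"
  shows "measure fair_coin {X. \<exists>K. finite K \<and> K \<subseteq> J \<and> M \<le> card K \<and> (\<forall>i\<in>K. X \<in> D i)}
    \<le> (\<Sum>i. if i \<in> J then (1/2) ^ w i else 0) / M"
proof -
  define u :: "nat \<Rightarrow> cantor \<Rightarrow> real" where "u n X = (\<Sum>i\<in>J \<inter> {..<n}. indicator (D i) X)" for n X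
  have u_card: "u n X = card {i \<in> J \<inter> {..<n}. X \<in> D i}" for n X
    by (simp add: u_def indicator_def Collect_conj_eq Int_assoc Int_commute Int_left_commute lessThan_def)
  have int: "integrable fair_coin (u n)" for n
    unfolding u_def by (intro Bochner_Integration.integrable_sum) (simp add: less_top[symmetric])
  have integral: "(\<integral>X. u n X \<partial>fair_coin) = (\<Sum>i\<in>J \<inter> {..<n}. measure fair_coin (D i))" for n
    unfolding u_def by (subst Bochner_Integration.integral_sum) (simp_all add: less_top[symmetric])
  let ?S = "\<lambda>n. {X. real M \<le> u n X}"
  have sets: "?S n \<in> sets fair_coin" for n
  proof -
    have "{X \<in> space fair_coin. real M \<le> u n X} \<in> sets fair_coin"
      using borel_measurable_integrable[OF int[of n]] by measurable
    then show ?thesis by simp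
  qed
  have bound: "measure fair_coin (?S n) \<le> (\<Sum>i. if i \<in> J then (1/2) ^ w i else 0) / M" for n
  proof -
    have "measure fair_coin (?S n) \<le> (\<integral>X. u n X \<partial>fair_coin) / M"
      using integral_Markov_inequality_measure[OF int[of n] sets.empty_sets, of "real M"] M
      by (simp add: u_def sum_nonneg)
    also have "(\<integral>X. u n X \<partial>fair_coin) \<le> (\<Sum>i\<in>J \<inter> {..<n}. (1/2) ^ w i)"
      unfolding integral by (intro sum_mono le)
    also have "\<dots> = (\<Sum>i<n. if i \<in> J then (1/2) ^ w i else 0)"
      by (simp add: sum.inter_restrict[symmetric] Int_commute)
    also have "\<dots> \<le> (\<Sum>i. if i \<in> J then (1/2) ^ w i else 0)"
      using w unfolding light_def by (intro sum_le_suminf) auto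
    finally show ?thesis using M by (simp add: divide_right_mono)
  qed
  have "incseq ?S"
    unfolding incseq_def u_card by (auto intro!: card_mono elim!: order_trans)
  then have lim: "(\<lambda>n. measure fair_coin (?S n)) \<longlonglongrightarrow> measure fair_coin (\<Union>n. ?S n)"
    using sets by (intro coin.finite_Lim_measure_incseq) auto
  moreover have "(\<Union>n. ?S n) = {X. \<exists>K. finite K \<and> K \<subseteq> J \<and> M \<le> card K \<and> (\<forall>i\<in>K. X \<in> D i)}"
  proof (intro set_eqI iffI)
    fix X assume "X \<in> (\<Union>n. ?S n)"
    then obtain n where "M \<le> card {i \<in> J \<inter> {..<n}. X \<in> D i}" unfolding u_card by auto
    then show "X \<in> {X. \<exists>K. finite K \<and> K \<subseteq> J \<and> M \<le> card K \<and> (\<forall>i\<in>K. X \<in> D i)}"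
      by (intro CollectI exI[of _ "{i \<in> J \<inter> {..<n}. X \<in> D i}"]) auto
  next
    fix X assume "X \<in> {X. \<exists>K. finite K \<and> K \<subseteq> J \<and> M \<le> card K \<and> (\<forall>i\<in>K. X \<in> D i)}"
    then obtain K where K: "finite K" "K \<subseteq> J" "M \<le> card K" "\<forall>i\<in>K. X \<in> D i" by blast
    obtain n where "K \<subseteq> {..<n}" using K(1) finite_nat_iff_bounded by blast
    then have "card K \<le> card {i \<in> J \<inter> {..<n}. X \<in> D i}"
      using K by (intro card_mono) auto
    then have "M \<le> card {i \<in> J \<inter> {..<n}. X \<in> D i}" using K(3) by linarith
    then show "X \<in> (\<Union>n. ?S n)" unfolding u_card by auto
  qed
  ultimately show ?thesis using LIMSEQ_le_const2[OF lim] bound by simp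
qed

text \<open>A Solovay test becomes a Martin-Loef test by collecting the points that lie in at least
  \<open>2 ^ (n + c)\<close> of its sets. The shift \<open>c\<close> absorbs the total weight, so
  that the bound for level \<open>n\<close> is exactly \<open>(1/2) ^ n\<close>.\<close>

theorem solovay_not_random:
  assumes J: "semidec A (\<lambda>i. i \<in> J)" and P: "semidec A (\<lambda>z. P (pr1 z) (pr2 z))"
    and D: "\<And>i. D i = {X. \<exists>k. P i (restr X k)}"
    and le: "\<And>i. measure fair_coin (D i) \<le> (1/2) ^ w i" and w: "light w J"
    and inf: "infinite {i \<in> J. X \<in> D i}"
  shows "\<not> random_rel A X"
proof -
  let ?C = "\<Sum>i. if i \<in> J then (1/2) ^ w i else (0::real)"
  obtain c where c: "?C \<le> 2 ^ c" using real_arch_pow[of 2 ?C] by (auto intro: less_imp_le)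
  define U where "U n = {X. \<exists>K. finite K \<and> K \<subseteq> J \<and> 2 ^ (n + c) \<le> card K \<and> (\<forall>i\<in>K. X \<in> D i)}" for n
  define Q where "Q n \<sigma> \<longleftrightarrow> (\<exists>l. distinct (list_decode l) \<and> 2 ^ (n + c) \<le> len l \<and>
    (\<forall>m<len l. nthc l m \<in> J \<and> (\<exists>k. k \<le> len \<sigma> \<and> P (nthc l m) (takec k \<sigma>))))" for n \<sigma>
  have "semidec A (\<lambda>z. Q (pr1 z) (pr2 z))"
    unfolding Q_def
    by (intro semidec_ex semidec_and semidec_ball semidec_compose[OF J] semidec_compose2[OF P] computable_intros | rule semidec_decidable)+
  moreover have "U n = {X. \<exists>k. Q n (restr X k)}" for n
  proof (intro set_eqI iffI)
    fix X assume "X \<in> U n"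
    then obtain K where K: "finite K" "K \<subseteq> J" "2 ^ (n + c) \<le> card K" "\<forall>i\<in>K. X \<in> D i"
      unfolding U_def by blast
    have "\<forall>i\<in>K. \<exists>k. P i (restr X k)" using K(4) unfolding D by blast
    then obtain f where f: "\<And>i. i \<in> K \<Longrightarrow> P i (restr X (f i))" by metis
    obtain xs where xs: "set xs = K" "distinct xs" using K(1) finite_distinct_list by blast
    define N where "N = (\<Sum>i\<in>K. f i)"
    have fN: "f i \<le> N" if "i \<in> K" for i unfolding N_def by (rule member_le_sum) (use K that in auto)
    have mem: "nthc (list_encode xs) m \<in> K" if "m < len (list_encode xs)" for m
      using that xs(1) by (auto simp: len_def nthc_def)
    have "nthc (list_encode xs) m \<in> J \<and> (\<exists>k\<le>len (restr X N). P (nthc (list_encode xs) m) (takec k (restr X N)))"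
      if m: "m < len (list_encode xs)" for m
      using f[OF mem[OF m]] fN[OF mem[OF m]] mem[OF m] K(2)
      by (intro conjI exI[of _ "f (nthc (list_encode xs) m)"]) (auto simp: min_absorb1)
    moreover have "2 ^ (n + c) \<le> len (list_encode xs)"
      using xs K(3) distinct_card[OF xs(2)] by (simp add: len_def)
    ultimately have "Q n (restr X N)"
      unfolding Q_def using xs(2) by (intro exI[of _ "list_encode xs"]) simp
    then show "X \<in> {X. \<exists>k. Q n (restr X k)}" by blast
  next
    fix X assume "X \<in> {X. \<exists>k. Q n (restr X k)}"
    then obtain N l where l: "distinct (list_decode l)" "2 ^ (n + c) \<le> len l"
      "\<forall>m<len l. nthc l m \<in> J \<and> (\<exists>k. k \<le> N \<and> P (nthc l m) (takec k (restr X N)))"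
      unfolding Q_def by auto
    then have "i \<in> J \<and> X \<in> D i" if "i \<in> elems l" for i
      using that unfolding elems_iff D by auto
    moreover have "finite (elems l)" "2 ^ (n + c) \<le> card (elems l)"
      using l(1,2) by (simp_all add: elems_def distinct_card len_def)
    ultimately show "X \<in> U n" unfolding U_def by blast
  qed
  ultimately have "uniformly_sigma1 A U" unfolding uniformly_sigma1_iff by blast
  moreover have "U (Suc n) \<subseteq> U n" for n
    unfolding U_def by (auto intro: order_trans[OF power_increasing[of _ _ "2::nat"]])
  moreover have "measure fair_coin (U n) \<le> (1/2) ^ n" for n
  proof -
    have "measure fair_coin (U n) \<le> ?C / real (2 ^ (n + c))"
      unfolding U_def by (rule prob_many_le[OF _ le w]) (auto simp: D)
    also have "\<dots> \<le> 2 ^ c / real (2 ^ (n + c))"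
      using c by (intro divide_right_mono) auto
    also have "\<dots> = (1/2) ^ n" by (simp add: power_add power_divide)
    finally show ?thesis .
  qed
  ultimately have "ml_test A U" unfolding ml_test_def by blast
  moreover have "X \<in> U n" for n
  proof -
    obtain K where "K \<subseteq> {i \<in> J. X \<in> D i}" "finite K" "card K = 2 ^ (n + c)"
      using infinite_arbitrarily_large[OF inf] by blast
    then show ?thesis unfolding U_def by (intro CollectI exI[of _ K]) auto
  qed
  ultimately show ?thesis unfolding random_rel_def by blast
qed


section \<open>Covering by sets of finite weight\<close>

definition in_block :: "(nat \<Rightarrow> nat) \<Rightarrow> nat \<Rightarrow> nat \<Rightarrow> bool" where
  "in_block w i c \<longleftrightarrow> (\<forall>j<w i. pair i j < len c \<and> nthc c (pair i j) = 1)"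

lemma in_block_restr: "in_block w i (restr X k) \<longleftrightarrow> X \<in> block w i \<and> (\<forall>j<w i. pair i j < k)"
  by (auto simp: in_block_def block_def nthc_restr)

lemma in_block_bound: "\<exists>b. \<forall>j<w i. pair i j < (b::nat)"
proof
  show "\<forall>j<w i. pair i j < Suc (\<Sum>j<w i. pair i j)"
    by (auto intro!: le_imp_less_Suc member_le_sum)
qed

lemma block_iff: "block w i = {X. \<exists>k. in_block w i (restr X k)}"
  unfolding in_block_restr using in_block_bound[of w i] by blast

lemma decidable_in_block [computable_intros]:
  assumes "computable A w" "computable A f" "computable A g"
  shows "decidable A (\<lambda>x. in_block w (f x) (g x))"
  unfolding in_block_def
  by (intro computable_intros computable_compose[OF assms(1)] computable_compose[OF assms(2)] computable_compose[OF assms(3)])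

text \<open>\<open>J\<close> collects the blocks whose intersection with \<open>F\<close> is small,
  which is enumerable because \<open>block w i - F\<close> is open relative to \<open>B\<close> and
  \<open>block w i\<close> has known measure. The small pieces together do not exhaust
  \<open>F\<close>, so the union of the collected blocks has measure below one. Including the
  indices below \<open>N\<close> lets applications disregard finitely many indices.\<close>

theorem light_cover_of_pi1:
  assumes w: "computable B w" and F: "pi1 B F" "measure fair_coin F > 0"
  shows "\<exists>J. semidec B (\<lambda>i. i \<in> J) \<and> light w J \<and> {..<N} \<subseteq> J \<and> {i. measure fair_coin (F \<inter> block w i) = 0} \<subseteq> J"
proof -
  obtain P where P: "semidec B P" "- F = {X. \<exists>k. P (restr X k)}"
    using F(1) unfolding pi1_def sigma1_iff by blast
  have setsF: "F \<in> sets fair_coin" using F(1) by (rule pi1_sets)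
  define Q where "Q i \<sigma> \<longleftrightarrow> in_block w i \<sigma> \<and> (\<exists>k. k \<le> len \<sigma> \<and> P (takec k \<sigma>))" for i \<sigma>
  have Q: "semidec B (\<lambda>z. Q (pr1 z) (pr2 z))"
    unfolding Q_def
    by (intro semidec_ex semidec_and semidec_compose[OF P(1)] computable_intros w | rule semidec_decidable)+
  have QK: "{X. \<exists>k. Q i (restr X k)} = block w i - F" for i
  proof (intro set_eqI iffI)
    fix X assume "X \<in> {X. \<exists>k. Q i (restr X k)}"
    then show "X \<in> block w i - F"
      using P(2) unfolding Q_def in_block_restr by (auto simp: set_eq_iff)
  next
    fix X assume X: "X \<in> block w i - F"
    then obtain k where k: "P (restr X k)" using P(2) by blast
    obtain b where "\<forall>j<w i. pair i j < b" using in_block_bound by blast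
    then have "Q i (restr X (max k b))"
      unfolding Q_def in_block_restr using X k by (auto intro!: exI[of _ k] simp: min_def)
    then show "X \<in> {X. \<exists>k. Q i (restr X k)}" by blast
  qed
  \<comment> \<open>The bounds \<open>(1/2) ^ (i + c)\<close> add up to
    \<open>2 * (1/2) ^ c\<close>, which must stay below the measure of \<open>F\<close>.\<close>
  obtain c where "(1/2) ^ c < measure fair_coin F / 2" using F(2) real_arch_pow_inv[of "measure fair_coin F / 2" "1/2"] by auto
  then have c: "2 * (1/2) ^ c < measure fair_coin F" by simp
  \<comment> \<open>The fraction is \<open>(1/2) ^ w i - (1/2) ^ (i + c) * (1/2) ^ w i\<close> in
    the form required by \<open>semidec_measure_gt\<close>.\<close>
  define J where "J = {i. real (2 ^ (i + c) - 1) / 2 ^ (i + c + w i) < measure fair_coin (block w i - F)}"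
  have J: "semidec B (\<lambda>i. i \<in> J)"
    using semidec_compose[OF semidec_measure_gt[OF Q], of "\<lambda>i. pair i (pair (2 ^ (i + c) - 1) (i + c + w i))"]
    unfolding J_def QK by (simp add: computable_intros w)
  have frac: "real (2 ^ (i + c) - 1) / 2 ^ (i + c + w i) = (1/2) ^ w i - (1/2) ^ (i + c) * (1/2) ^ w i" for i
    by (simp add: of_nat_diff power_add field_simps power_divide)
  have split: "measure fair_coin (block w i - F) = (1/2) ^ w i - measure fair_coin (F \<inter> block w i)" for i
    using coin.finite_measure_Diff'[OF sets_block[of w i] setsF] by (simp add: prob_block Int_commute)
  have J_iff: "i \<in> J \<longleftrightarrow> measure fair_coin (F \<inter> block w i) < (1/2) ^ (i + c) * (1/2) ^ w i" for i
    unfolding J_def mem_Collect_eq frac split by auto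
  have "light w J"
  proof (rule light_if_blocks_small)
    have sets: "(\<Union>i\<in>J. F \<inter> block w i) \<in> sets fair_coin" "(\<Union>i\<in>J. block w i) \<in> sets fair_coin"
      using setsF by (auto intro!: sets.countable_UN')
    have geom: "(\<lambda>i. (1/2) ^ c * (1/2) ^ i) sums ((1/2) ^ c * (2::real))"
      using geometric_sums[of "1/2::real"] by (intro sums_mult) simp
    define G where "G i = (if i \<in> J then F \<inter> block w i else {})" for i
    have G: "measure fair_coin (G i) \<le> (1/2) ^ c * (1/2) ^ i" for i
    proof (cases "i \<in> J")
      case True
      then have "measure fair_coin (G i) \<le> (1/2) ^ (i + c) * (1/2) ^ w i"
        unfolding J_iff by (simp add: G_def J_iff)
      also have "\<dots> \<le> (1/2) ^ (i + c) * 1"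
        by (intro mult_left_mono power_le_one) auto
      finally show ?thesis by (simp add: power_add mult.commute)
    qed (simp add: G_def)
    have sG: "summable (\<lambda>i. measure fair_coin (G i))"
      by (rule summable_comparison_test[OF _ sums_summable[OF geom]]) (use G in auto)
    have "measure fair_coin (\<Union>i. G i) \<le> (\<Sum>i. measure fair_coin (G i))"
      using setsF sG by (intro coin.finite_measure_subadditive_countably) (auto simp: G_def)
    also have "\<dots> \<le> 2 * (1/2) ^ c"
      using suminf_le[OF G sG sums_summable[OF geom]] sums_unique[OF geom] by simp
    also have "(\<Union>i. G i) = F \<inter> (\<Union>i\<in>J. block w i)" by (auto simp: G_def)
    finally have "measure fair_coin (F \<inter> (\<Union>i\<in>J. block w i)) < measure fair_coin F" using c by simp
    moreover have "measure fair_coin (F - (\<Union>i\<in>J. block w i)) = measure fair_coin F - measure fair_coin (F \<inter> (\<Union>i\<in>J. block w i))"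
      using coin.finite_measure_Diff'[OF setsF sets(2)] .
    moreover have "measure fair_coin (F - (\<Union>i\<in>J. block w i)) \<le> measure fair_coin (space fair_coin - (\<Union>i\<in>J. block w i))"
      using sets.compl_sets[OF sets(2)] by (intro coin.finite_measure_mono) auto
    ultimately show "measure fair_coin (\<Union>i\<in>J. block w i) < 1"
      using coin.prob_compl[OF sets(2)] by simp
  qed
  then have "light w ({..<N} \<union> J)" by (rule light_Un[OF light_finite[OF finite_lessThan]])
  moreover have "semidec B (\<lambda>i. i < N \<or> i \<in> J)"
    by (intro semidec_or J semidec_decidable computable_intros)
  moreover have "{i. measure fair_coin (F \<inter> block w i) = 0} \<subseteq> J" by (auto simp: J_iff)
  ultimately show ?thesis by (intro exI[of _ "{..<N} \<union> J"]) auto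
qed

text \<open>The weight function has to be computable in every oracle because it is used relative to
  \<open>A\<close> for \<open>I\<close> and relative to \<open>B\<close> for
  \<open>J\<close>.\<close>

definition covers :: "cantor \<Rightarrow> cantor \<Rightarrow> bool" where
  "covers A B \<longleftrightarrow> (\<forall>w I. (\<forall>C. computable C w) \<and> semidec A (\<lambda>i. i \<in> I) \<and> light w I \<longrightarrow>
     (\<exists>J. semidec B (\<lambda>i. i \<in> J) \<and> light w J \<and> I \<subseteq> J))"

lemma sigma1_Un: assumes "sigma1 A U" "sigma1 A V" shows "sigma1 A (U \<union> V)"
proof -
  obtain P Q where "semidec A P" "U = {X. \<exists>k. P (restr X k)}" "semidec A Q" "V = {X. \<exists>k. Q (restr X k)}"
    using assms unfolding sigma1_iff by blast
  then show ?thesis unfolding sigma1_iff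
    by (intro exI[of _ "\<lambda>c. P c \<or> Q c"]) (auto intro: semidec_or)
qed

lemma uniformly_sigma1_sigma1: assumes "uniformly_sigma1 A U" shows "sigma1 A (U n)"
proof -
  obtain P where P: "semidec A (\<lambda>z. P (pr1 z) (pr2 z))" "\<And>n. U n = {X. \<exists>k. P n (restr X k)}"
    using assms unfolding uniformly_sigma1_iff by blast
  then show ?thesis unfolding sigma1_iff
    by (intro exI[of _ "P n"] conjI semidec_compose2[OF P(1)] computable_intros) simp
qed

lemma pi1_block: assumes "computable A w" shows "pi1 A (block w i)"
proof -
  have "- block w i = {X. \<exists>k. \<exists>j<w i. pair i j < len (restr X k) \<and> nthc (restr X k) (pair i j) = 0}"
    by (auto simp: block_def nthc_restr)
  moreover have "semidec A (\<lambda>c. \<exists>j<w i. pair i j < len c \<and> nthc c (pair i j) = 0)"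
    by (intro semidec_decidable computable_intros)
  ultimately show ?thesis unfolding pi1_def sigma1_iff by blast
qed

lemma covers_if_subclasses:
  assumes sub: "\<And>P. pi1 A P \<Longrightarrow> \<exists>S. sigma2 B S \<and> S \<subseteq> P \<and> measure fair_coin S = measure fair_coin P"
  shows "covers A B"
  unfolding covers_def
proof (intro allI impI, elim conjE)
  fix w I assume w: "\<forall>C. computable C w" and I: "semidec A (\<lambda>i. i \<in> I)" and light: "light w I"
  let ?f = "\<lambda>i. if i \<in> I then (1/2) ^ w i else 0 :: real"
  \<comment> \<open>Dropping finitely many indices leaves weight below one, so the complement of the
    union of the remaining blocks is a class of positive measure.\<close>
  obtain N where "norm (\<Sum>i. ?f (i + N)) < 1"
    using suminf_exist_split[OF _ light[unfolded light_def], of 1] by auto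
  then have N: "(\<Sum>i. ?f (i + N)) < 1" by (simp add: abs_less_iff)
  have sf: "summable (\<lambda>i. ?f (i + N))" using light unfolding light_def by (rule summable_ignore_initial_segment)
  define U where "U = (\<Union>i\<in>{i. i \<in> I \<and> N \<le> i}. block w i)"
  have "U = {X. \<exists>k i. i \<in> I \<and> N \<le> i \<and> in_block w i (restr X k)}"
    unfolding U_def block_iff by blast
  moreover have "semidec A (\<lambda>c. \<exists>i. i \<in> I \<and> N \<le> i \<and> in_block w i c)"
    by (intro semidec_ex semidec_and semidec_compose[OF I] computable_intros w[rule_format] | rule semidec_decidable)+
  ultimately have U: "sigma1 A U" unfolding sigma1_iff by blast
  define G where "G i = (if i + N \<in> I then block w (i + N) else {})" for i
  have G: "measure fair_coin (G i) = ?f (i + N)" for i by (simp add: G_def prob_block)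
  have "U = (\<Union>i. G i)"
    unfolding U_def G_def by (auto split: if_splits) (metis le_add_diff_inverse2)
  moreover have "summable (\<lambda>i. measure fair_coin (G i))" unfolding G by (rule sf)
  ultimately have "measure fair_coin U \<le> (\<Sum>i. measure fair_coin (G i))"
    by (simp only:) (intro coin.finite_measure_subadditive_countably, auto simp: G_def)
  then have "measure fair_coin U < 1" using N by (simp only: G)
  then have pos: "measure fair_coin (- U) > 0"
    using coin.prob_compl[OF sigma1_sets[OF U]] by (simp add: Compl_eq_Diff_UNIV)
  obtain S where S: "sigma2 B S" "S \<subseteq> - U" "measure fair_coin S = measure fair_coin (- U)"
    using sub[of "- U"] U by (auto simp: pi1_def)
  obtain F where F: "uniformly_pi1 B F" "S = (\<Union>n. F n)" using S(1) unfolding sigma2_def by blast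
  have pF: "pi1 B (F n)" for n
    using uniformly_sigma1_sigma1[of B "\<lambda>n. - F n"] F(1) unfolding uniformly_pi1_def pi1_def by blast
  \<comment> \<open>A countable union of null components would be null, whereas \<open>S\<close> has
    the positive measure of \<open>- U\<close>.\<close>
  have "\<exists>n. measure fair_coin (F n) > 0"
  proof (rule ccontr)
    assume "\<nexists>n. measure fair_coin (F n) > 0"
    then have "F n \<in> null_sets fair_coin" for n
      using pi1_sets[OF pF[of n]]
      by (intro null_setsI) (auto simp: coin.emeasure_eq_measure not_less measure_le_0_iff)
    then have "S \<in> null_sets fair_coin" unfolding F(2) by (intro null_sets_UN) auto
    then show False using pos S(3) by (simp add: measure_eq_0_null_sets)
  qed
  then obtain n where n: "measure fair_coin (F n) > 0" ..
  obtain J where J: "semidec B (\<lambda>i. i \<in> J)" "light w J" "{..<N} \<subseteq> J"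
    "{i. measure fair_coin (F n \<inter> block w i) = 0} \<subseteq> J"
    using light_cover_of_pi1[OF _ pF n] w by blast
  have "I \<subseteq> J"
  proof
    fix i assume i: "i \<in> I"
    show "i \<in> J"
    proof (cases "i < N")
      case False
      then have "F n \<inter> block w i = {}" using i S(2) unfolding F(2) U_def by fastforce
      then show ?thesis using J(4) by auto
    qed (use J(3) in auto)
  qed
  then show "\<exists>J. semidec B (\<lambda>i. i \<in> J) \<and> light w J \<and> I \<subseteq> J" using J by blast
qed


section \<open>Forcing a random point\<close>

lemma compact_cantor: "compact (UNIV :: cantor set)"
proof -
  have "compact_space (product_topology (\<lambda>_ :: nat. euclidean :: bool topology) UNIV)"
    unfolding compact_space_product_topology by (auto simp: compact_space_def finite_imp_compact)
  then show ?thesis by (simp add: euclidean_product_topology compact_space_def)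
qed

lemma open_open_class: "open {X :: cantor. \<exists>k. P (restr X k)}"
proof -
  have coord: "open {X :: cantor. X i = b}" for i b
  proof -
    have "open ((\<lambda>X :: cantor. X i) -` {b})"
      by (intro open_vimage continuous_on_product_coordinates) (rule discrete_topology_class.open_discrete)
    then show ?thesis by (simp add: vimage_def)
  qed
  have "open {X :: cantor. restr X k = restr Y k}" for k Y
  proof -
    have "{X :: cantor. restr X k = restr Y k} = (\<Inter>i\<in>{..<k}. {X. X i = Y i})"
      unfolding restr_eq_iff by auto
    then show ?thesis using coord by (simp only:) (intro open_INT, auto)
  qed
  then have "open (\<Union>k. \<Union>Y\<in>{Y. P (restr Y k)}. {X :: cantor. restr X k = restr Y k})"
    by (intro open_UN ballI)
  also have "(\<Union>k. \<Union>Y\<in>{Y. P (restr Y k)}. {X :: cantor. restr X k = restr Y k}) = {X. \<exists>k. P (restr X k)}"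
    by (auto, metis)
  finally show ?thesis .
qed

lemma pi1_closed: "pi1 A P \<Longrightarrow> closed P"
  unfolding pi1_def sigma1_iff closed_def using open_open_class by auto

lemma closed_decseq_Inter_nonempty:
  assumes "\<And>n. closed (F n :: cantor set)" "\<And>n. F n \<noteq> {}" "\<And>n. F (Suc n) \<subseteq> F n"
  shows "\<exists>X. \<forall>n. X \<in> F n"
proof -
  have anti: "F n \<subseteq> F m" if "m \<le> n" for m n
    using that assms(3) by (rule lift_Suc_antimono_le[rotated])
  have "UNIV \<inter> (\<Inter>n\<in>UNIV. F n) \<noteq> {}"
  proof (rule compact_imp_fip_image[OF compact_cantor])
    fix N :: "nat set" assume "finite N"
    then obtain m where "\<forall>n\<in>N. n \<le> m" using finite_nat_set_iff_bounded_le by blast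
    then have "F m \<subseteq> (\<Inter>n\<in>N. F n)" using anti by blast
    then show "UNIV \<inter> (\<Inter>n\<in>N. F n) \<noteq> {}" using assms(2)[of m] by auto
  qed (rule assms(1))
  then show ?thesis by auto
qed

text \<open>Forcing needs only countably many requirements, so the enumeration need not be
  effective. At a number outside the range, \<open>inv goedel\<close> is some unspecified program,
  which merely adds one more sequence.\<close>

lemma enumerate_uniformly_sigma1:
  obtains T :: "nat \<Rightarrow> nat \<Rightarrow> cantor set" where "\<And>U. uniformly_sigma1 B U \<Longrightarrow> \<exists>k. T k = U"
proof -
  define T where "T = (\<lambda>e n. {X. \<exists>k. halts B (inv goedel e) (pair n (restr X k))})"
  have "\<exists>e. T e = U" if U: "uniformly_sigma1 B U" for U
  proof -
    obtain P where P: "semidec B (\<lambda>z. P (pr1 z) (pr2 z))" "\<And>n. U n = {X. \<exists>k. P n (restr X k)}"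
      using U unfolding uniformly_sigma1_iff by blast
    obtain p where "{z. P (pr1 z) (pr2 z)} = {z. halts B p z}"
      using P(1) unfolding ce_iff_semidec[symmetric] ce_def by blast
    then have "P n c \<longleftrightarrow> halts B p (pair n c)" for n c
      by (metis mem_Collect_eq pr_pair)
    moreover have "inv goedel (goedel p) = p" using goedel_inj by (simp add: inj_def)
    ultimately have "T (goedel p) = U" by (simp add: T_def P(2) fun_eq_iff)
    then show ?thesis ..
  qed
  then show ?thesis by (rule that)
qed

lemma pi1_Int: "pi1 A P \<Longrightarrow> pi1 A Q \<Longrightarrow> pi1 A (P \<inter> Q)"
  unfolding pi1_def using sigma1_Un by (simp add: Compl_Int)

lemma pi1_Diff: "pi1 A P \<Longrightarrow> sigma1 A U \<Longrightarrow> pi1 A (P - U)"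
  unfolding pi1_def using sigma1_Un[of A "- P" U] by (simp add: Diff_eq)

text \<open>
  If a light \<open>I\<close> had no light \<open>B\<close>-c.e. superset, then every \<open>\<Pi>\<^sub>1\<close> class of positive measure would
  meet infinitely many blocks of \<open>I\<close> in positive measure. Intersecting with such blocks while
  removing a component of every test relative to \<open>B\<close> leads to a \<open>B\<close>-random point that fails the
  Solovay test relative to \<open>A\<close> given by \<open>I\<close>.
\<close>

lemma covers_if_LR_le:
  assumes LR: "A \<le>\<^sub>L\<^sub>R B" shows "covers A B"
  unfolding covers_def
proof (intro allI impI, elim conjE, rule ccontr)
  fix w I assume w: "\<forall>C. computable C w" and I: "semidec A (\<lambda>i. i \<in> I)" and light: "light w I"
    and no: "\<nexists>J. semidec B (\<lambda>i. i \<in> J) \<and> light w J \<and> I \<subseteq> J"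
  obtain T :: "nat \<Rightarrow> nat \<Rightarrow> cantor set" where T: "\<And>U. uniformly_sigma1 B U \<Longrightarrow> \<exists>k. T k = U"
    using enumerate_uniformly_sigma1 by blast
  define ok where "ok F \<longleftrightarrow> pi1 B F \<and> measure fair_coin F > 0" for F
  have UNIV: "ok UNIV"
  proof -
    have "semidec B (\<lambda>_. False)" by (intro semidec_decidable computable_intros)
    then have "pi1 B UNIV" unfolding pi1_def sigma1_iff by (intro exI[of _ "\<lambda>_. False"]) auto
    then show ?thesis using coin.prob_space by (simp add: ok_def)
  qed
  have step: "\<exists>F'. ok F' \<and> F' \<subseteq> F \<and> (\<exists>i\<in>I. k \<le> i \<and> F' \<subseteq> block w i) \<and>
      (ml_test B (T k) \<longrightarrow> (\<exists>n. F' \<inter> T k n = {}))" if F: "ok F" for F k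
  proof -
    obtain J where J: "semidec B (\<lambda>i. i \<in> J)" "light w J" "{..<k} \<subseteq> J"
      "{i. measure fair_coin (F \<inter> block w i) = 0} \<subseteq> J"
      using light_cover_of_pi1[of B w F k] w F unfolding ok_def by blast
    then obtain i where i: "i \<in> I" "i \<notin> J" using no by blast
    then have "k \<le> i" using J(3) by (meson lessThan_iff not_le subsetD)
    have "measure fair_coin (F \<inter> block w i) > 0"
      using i(2) J(4) by (auto simp: zero_less_measure_iff)
    then have F1: "ok (F \<inter> block w i)"
      using F w unfolding ok_def by (auto intro: pi1_Int pi1_block)
    show ?thesis
    proof (cases "ml_test B (T k)")
      case False
      then show ?thesis using F1 i(1) \<open>k \<le> i\<close> by blast
    next
      case True
      \<comment> \<open>A component of the test that is smaller than the current class can be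
        removed without losing positive measure.\<close>
      obtain n where n: "(1/2) ^ n < measure fair_coin (F \<inter> block w i)"
        using F1 real_arch_pow_inv[of _ "1/2"] unfolding ok_def by auto
      let ?F = "F \<inter> block w i - T k n"
      have U: "sigma1 B (T k n)" "measure fair_coin (T k n) \<le> (1/2) ^ n"
        using True uniformly_sigma1_sigma1 unfolding ml_test_def by blast+
      have sets: "F \<inter> block w i \<in> sets fair_coin" "T k n \<in> sets fair_coin"
        using F1 U(1) pi1_sets sigma1_sets unfolding ok_def by blast+
      have "measure fair_coin (F \<inter> block w i) - measure fair_coin (T k n) \<le> measure fair_coin ?F"
        using sets coin.finite_measure_mono[of "F \<inter> block w i \<inter> T k n" "T k n"]
        by (subst coin.finite_measure_Diff') auto
      then have "ok ?F"
        using n U F1 pi1_Diff unfolding ok_def by force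
      then show ?thesis using i(1) \<open>k \<le> i\<close> by blast
    qed
  qed
  obtain F where F: "\<And>k. ok (F k)" "\<And>k. F (Suc k) \<subseteq> F k \<and> (\<exists>i\<in>I. k \<le> i \<and> F (Suc k) \<subseteq> block w i) \<and>
      (ml_test B (T k) \<longrightarrow> (\<exists>n. F (Suc k) \<inter> T k n = {}))"
    using dependent_nat_choice[of "\<lambda>_. ok" "\<lambda>k F F'. F' \<subseteq> F \<and> (\<exists>i\<in>I. k \<le> i \<and> F' \<subseteq> block w i) \<and>
      (ml_test B (T k) \<longrightarrow> (\<exists>n. F' \<inter> T k n = {}))"] UNIV step by metis
  have "F k \<noteq> {}" for k using F(1)[of k] unfolding ok_def by auto
  moreover have "closed (F k)" for k using F(1)[of k] pi1_closed unfolding ok_def by blast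
  ultimately obtain X where X: "\<And>k. X \<in> F k"
    using closed_decseq_Inter_nonempty[of F] F(2) by blast
  have "random_rel B X"
    unfolding random_rel_def
  proof (intro allI impI)
    fix U assume U: "ml_test B U"
    then obtain k where "T k = U" using T unfolding ml_test_def by blast
    then obtain n where "F (Suc k) \<inter> U n = {}" using F(2)[of k] U by blast
    then show "X \<notin> (\<Inter>n. U n)" using X[of "Suc k"] by blast
  qed
  moreover have "\<not> random_rel A X"
  proof (rule solovay_not_random[OF I _ block_iff _ light])
    show "semidec A (\<lambda>z. in_block w (pr1 z) (pr2 z))"
      by (intro semidec_decidable computable_intros w[rule_format])
    show "measure fair_coin (block w i) \<le> (1/2) ^ w i" for i by (simp add: prob_block)
    show "infinite {i \<in> I. X \<in> block w i}"
      unfolding infinite_nat_iff_unbounded_le using F(2) X by blast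
  qed
  ultimately show False using LR unfolding LR_le_def by blast
qed


section \<open>Disjoint presentations of open classes\<close>

definition cyl :: "nat \<Rightarrow> cantor set" where "cyl c = {X. restr X (len c) = c}"

lemma cyl_iff: "cyl c = {X. \<exists>k. restr X k = c}"
  unfolding cyl_def using len_restr by metis

lemma sets_cyl [measurable]: "cyl c \<in> sets fair_coin"
  unfolding cyl_iff by (rule sets_open_class)

lemma prob_cyl_le: "measure fair_coin (cyl c) \<le> (1/2) ^ len c"
  unfolding cyl_def by (rule prob_restr_le)

abbreviation oracle_part :: "nat \<Rightarrow> nat" where "oracle_part i \<equiv> pr1 (pr2 i)"
abbreviation string_part :: "nat \<Rightarrow> nat" where "string_part i \<equiv> pr2 (pr2 i)"

text \<open>Separates the oracle from the enumeration: \<open>V\<close> is decidable in any oracle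
  because the prefix of \<open>A\<close> is an argument. One length serves for the oracle prefix and
  for the prefix of the point, and acceptance persists when it grows.\<close>

lemma uniformly_sigma1_use:
  assumes "uniformly_sigma1 A U"
  obtains V where "\<And>B. decidable B (\<lambda>i. V (pr1 i) (oracle_part i) (string_part i))"
    "\<And>n X. X \<in> U n \<longleftrightarrow> (\<exists>k. V n (restr A k) (restr X k))"
    "\<And>n X k k'. V n (restr A k) (restr X k) \<Longrightarrow> k \<le> k' \<Longrightarrow> V n (restr A k') (restr X k')"
proof -
  obtain P where P: "semidec A (\<lambda>z. P (pr1 z) (pr2 z))" "\<And>n. U n = {X. \<exists>k. P n (restr X k)}"
    using assms unfolding uniformly_sigma1_iff by blast
  have "ce A {z. P (pr1 z) (pr2 z)}" using P(1) unfolding ce_iff_semidec .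
  then obtain R where R: "\<And>B. decidable B R"
    "\<And>z. z \<in> {z. P (pr1 z) (pr2 z)} \<longleftrightarrow> (\<exists>k. R (pair (restr A k) z))"
    by (rule ce_normal_form) blast
  have R': "P n c \<longleftrightarrow> (\<exists>k. R (pair (restr A k) (pair n c)))" for n c
    using R(2)[of "pair n c"] by simp
  define V where "V n \<tau> \<sigma> \<longleftrightarrow> (\<exists>k\<le>len \<sigma>. \<exists>j\<le>len \<tau>. R (pair (takec j \<tau>) (pair n (takec k \<sigma>))))" for n \<tau> \<sigma>
  have V: "V n (restr A K) (restr X K) \<longleftrightarrow> (\<exists>k\<le>K. \<exists>j\<le>K. R (pair (restr A j) (pair n (restr X k))))" for n X K
    unfolding V_def by (auto simp: min_absorb1 cong: conj_cong)
  show ?thesis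
  proof (rule that)
    show "decidable B (\<lambda>i. V (pr1 i) (oracle_part i) (string_part i))" for B
      unfolding V_def by (intro computable_intros decidable_compose[OF R(1)])
    show "X \<in> U n \<longleftrightarrow> (\<exists>k. V n (restr A k) (restr X k))" for n X
    proof
      assume "X \<in> U n"
      then obtain k j where "R (pair (restr A j) (pair n (restr X k)))" unfolding P(2) R' by blast
      then have "V n (restr A (max j k)) (restr X (max j k))" unfolding V by (meson max.cobounded1 max.cobounded2)
      then show "\<exists>k. V n (restr A k) (restr X k)" ..
    qed (unfold V P(2) R', blast)
    show "V n (restr A k') (restr X k')" if "V n (restr A k) (restr X k)" "k \<le> k'" for n X k k'
      using that unfolding V by (meson order_trans)
  qed
qed

text \<open>Stopping at the first accepting length gives, for each \<open>n\<close>, disjoint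
  cylinders inside \<open>U n\<close>, whose measures add up to at most that of \<open>U n\<close>.
  The correction \<open>v n\<close> pushes the weight for \<open>n\<close> below
  \<open>(1/2) ^ n\<close>: 0 suffices for a Martin-Loef test, and \<open>n\<close> for an arbitrary
  sequence.\<close>

lemma disjoint_presentation:
  assumes U: "uniformly_sigma1 A U"
    and v: "\<And>n. (1/2) ^ v n * measure fair_coin (U n) \<le> (1/2) ^ n"
  obtains V I where "\<And>B. decidable B (\<lambda>i. V (pr1 i) (oracle_part i) (string_part i))"
    "\<And>n X. X \<in> U n \<longleftrightarrow> (\<exists>k. V n (restr A k) (restr X k))"
    "semidec A (\<lambda>i. i \<in> I)" "light (\<lambda>i. len (string_part i) + v (pr1 i)) I"
    "\<And>i. i \<in> I \<Longrightarrow> V (pr1 i) (oracle_part i) (string_part i) \<and> len (oracle_part i) = len (string_part i) \<and>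
      oracle_part i = restr A (len (oracle_part i))"
    "\<And>n X. X \<in> U n \<Longrightarrow> \<exists>i\<in>I. pr1 i = n \<and> X \<in> cyl (string_part i)"
proof -
  obtain V where V: "\<And>B. decidable B (\<lambda>i. V (pr1 i) (oracle_part i) (string_part i))"
    "\<And>n X. X \<in> U n \<longleftrightarrow> (\<exists>k. V n (restr A k) (restr X k))"
    "\<And>n X k k'. V n (restr A k) (restr X k) \<Longrightarrow> k \<le> k' \<Longrightarrow> V n (restr A k') (restr X k')"
    using uniformly_sigma1_use[OF U] by blast
  have decV: "decidable B (\<lambda>x. V (f x) (g x) (h x))"
    if "computable B f" "computable B g" "computable B h" for B f g h
    using decidable_compose[OF V(1), of B "\<lambda>x. pair (f x) (pair (g x) (h x))"] that by (simp add: computable_intros)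
  \<comment> \<open>For the prefixes of \<open>A\<close> and of a point, acceptance is monotone in
    the length. Hence the first accepting length is recognised by its predecessor alone, and length
    0 has none.\<close>
  define new where "new i \<longleftrightarrow> V (pr1 i) (oracle_part i) (string_part i) \<and>
    (len (string_part i) = 0 \<or>
     \<not> V (pr1 i) (takec (len (string_part i) - 1) (oracle_part i)) (takec (len (string_part i) - 1) (string_part i)))" for i
  define I where "I = {i. is_str (string_part i) \<and> len (oracle_part i) = len (string_part i) \<and>
    oracle_part i = restr A (len (oracle_part i)) \<and> new i}"
  have decA: "decidable A A" using computable_oracle[OF computable_id] .
  have I: "semidec A (\<lambda>i. i \<in> I)"
    unfolding I_def new_def mem_Collect_eq by (intro semidec_decidable decA decV computable_intros)
  have IX: "i \<in> I \<and> X \<in> cyl (string_part i) \<longleftrightarrow>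
      (\<exists>k. i = pair (pr1 i) (pair (restr A k) (restr X k)) \<and> V (pr1 i) (restr A k) (restr X k) \<and>
        (k = 0 \<or> \<not> V (pr1 i) (restr A (k - 1)) (restr X (k - 1))))" for i X
  proof
    assume i: "i \<in> I \<and> X \<in> cyl (string_part i)"
    define k where "k = len (string_part i)"
    have "string_part i = restr X k" "oracle_part i = restr A k" using i by (auto simp: I_def cyl_def k_def)
    moreover from this have "i = pair (pr1 i) (pair (restr A k) (restr X k))" by (metis pair_pr)
    moreover have "new i" using i by (simp add: I_def)
    ultimately show "\<exists>k. i = pair (pr1 i) (pair (restr A k) (restr X k)) \<and> V (pr1 i) (restr A k) (restr X k) \<and>
        (k = 0 \<or> \<not> V (pr1 i) (restr A (k - 1)) (restr X (k - 1)))"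
      unfolding new_def by (intro exI[of _ k]) (simp add: min_absorb1)
  next
    assume "\<exists>k. i = pair (pr1 i) (pair (restr A k) (restr X k)) \<and> V (pr1 i) (restr A k) (restr X k) \<and>
        (k = 0 \<or> \<not> V (pr1 i) (restr A (k - 1)) (restr X (k - 1)))"
    then obtain n k where "i = pair n (pair (restr A k) (restr X k))" "V n (restr A k) (restr X k)"
        "k = 0 \<or> \<not> V n (restr A (k - 1)) (restr X (k - 1))" by (metis pr_pair(1))
    then show "i \<in> I \<and> X \<in> cyl (string_part i)"
      by (simp add: I_def new_def cyl_def min_absorb1)
  qed
  have unique: "i = i'" if i: "i \<in> I" "X \<in> cyl (string_part i)" and i': "i' \<in> I" "X \<in> cyl (string_part i')"
    and eq: "pr1 i = pr1 i'" for i i' X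
  proof -
    obtain k where k: "i = pair (pr1 i) (pair (restr A k) (restr X k))" "V (pr1 i) (restr A k) (restr X k)"
      "k = 0 \<or> \<not> V (pr1 i) (restr A (k - 1)) (restr X (k - 1))" using IX i by blast
    obtain k' where k': "i' = pair (pr1 i) (pair (restr A k') (restr X k'))" "V (pr1 i) (restr A k') (restr X k')"
      "k' = 0 \<or> \<not> V (pr1 i) (restr A (k' - 1)) (restr X (k' - 1))" using IX i' eq by metis
    have "\<not> k < k'" using V(3)[OF k(2), of "k' - 1"] k'(3) by fastforce
    moreover have "\<not> k' < k" using V(3)[OF k'(2), of "k - 1"] k(3) by fastforce
    ultimately have "k = k'" by simp
    then show ?thesis using k(1) k'(1) by metis
  qed
  have sub: "X \<in> U (pr1 i)" if "i \<in> I" "X \<in> cyl (string_part i)" for i X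
    using IX V(2) that by blast
  have light: "light (\<lambda>i. len (string_part i) + v (pr1 i)) I"
  proof (rule lightI)
    fix m
    let ?F = "I \<inter> {..<m}"
    have "(\<Sum>i\<in>?F. (1/2) ^ (len (string_part i) + v (pr1 i)) :: real) =
        (\<Sum>n<m. \<Sum>i\<in>{i\<in>?F. pr1 i = n}. (1/2) ^ (len (string_part i) + v (pr1 i)))"
      by (intro sum.group[symmetric]) (auto intro: le_less_trans[OF pr1_le])
    also have "\<dots> \<le> (\<Sum>n<m. (1/2) ^ n)"
    proof (rule sum_mono)
      fix n
      have *: "(\<Sum>i\<in>{i\<in>?F. pr1 i = n}. measure fair_coin (cyl (string_part i))) =
          measure fair_coin (\<Union>i\<in>{i\<in>?F. pr1 i = n}. cyl (string_part i))"
        by (intro coin.finite_measure_finite_Union[symmetric])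
           (auto simp: disjoint_family_on_def disjoint_iff dest: unique)
      have "(\<Sum>i\<in>{i\<in>?F. pr1 i = n}. (1/2) ^ (len (string_part i) + v (pr1 i)) :: real) =
          (1/2) ^ v n * (\<Sum>i\<in>{i\<in>?F. pr1 i = n}. measure fair_coin (cyl (string_part i)))"
        unfolding sum_distrib_left
        by (intro sum.cong) (auto simp: I_def cyl_def prob_restr_eq power_add)
      also have "\<dots> \<le> (1/2) ^ v n * measure fair_coin (U n)"
        unfolding * using sub sigma1_sets[OF uniformly_sigma1_sigma1[OF U]]
        by (intro mult_left_mono coin.finite_measure_mono) auto
      finally show "(\<Sum>i\<in>{i\<in>?F. pr1 i = n}. (1/2) ^ (len (string_part i) + v (pr1 i))) \<le> (1/2 :: real) ^ n"
        using v[of n] by linarith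
    qed
    also have "\<dots> \<le> (2 :: real)" by (simp add: sum_gp_strict)
    finally show "(\<Sum>i\<in>?F. (1/2) ^ (len (string_part i) + v (pr1 i))) \<le> (2 :: real)" .
  qed
  have cover: "\<exists>i\<in>I. pr1 i = n \<and> X \<in> cyl (string_part i)" if "X \<in> U n" for n X
  proof -
    define k where "k = (LEAST k. V n (restr A k) (restr X k))"
    have ex: "\<exists>k. V n (restr A k) (restr X k)" using V(2) that by blast
    have "\<not> V n (restr A j) (restr X j)" if "j < k" for j
      using not_less_Least[OF that[unfolded k_def]] .
    then have "k = 0 \<or> \<not> V n (restr A (k - 1)) (restr X (k - 1))"
      by (cases k) auto
    moreover have "V n (restr A k) (restr X k)" unfolding k_def using LeastI_ex[OF ex] .
    ultimately have "pair n (pair (restr A k) (restr X k)) \<in> I \<and> X \<in> cyl (string_part (pair n (pair (restr A k) (restr X k))))"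
      unfolding IX by (intro exI[of _ k]) simp
    then show ?thesis by (intro bexI[of _ "pair n (pair (restr A k) (restr X k))"]) simp_all
  qed
  show ?thesis
  proof (rule that[OF V(1,2) I light _ cover])
    show "V (pr1 i) (oracle_part i) (string_part i) \<and> len (oracle_part i) = len (string_part i) \<and>
        oracle_part i = restr A (len (oracle_part i))" if "i \<in> I" for i
      using that unfolding I_def new_def by blast
  qed
qed

text \<open>A test relative to \<open>A\<close> is presented by a light set of cylinders. Its light
  \<open>B\<close>-c.e. cover is a Solovay test relative to \<open>B\<close>, failed by every point
  that fails the original test.\<close>

lemma LR_le_if_covers:
  assumes "covers A B" shows "A \<le>\<^sub>L\<^sub>R B"
  unfolding LR_le_def
proof (intro allI impI, rule ccontr)
  fix X assume B: "random_rel B X" and A: "\<not> random_rel A X"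
  then obtain U where U: "ml_test A U" "\<And>n. X \<in> U n" unfolding random_rel_def by blast
  obtain V I where I: "semidec A (\<lambda>i. i \<in> I)" "light (\<lambda>i. len (string_part i) + 0) I"
    "\<And>n X. X \<in> U n \<Longrightarrow> \<exists>i\<in>I. pr1 i = n \<and> X \<in> cyl (string_part i)"
    by (rule disjoint_presentation[of A U "\<lambda>_. 0"]) (use U(1) in \<open>simp_all add: ml_test_def\<close>)
  have "computable C (\<lambda>i. len (string_part i) + 0)" for C by (intro computable_intros)
  then obtain J where J: "semidec B (\<lambda>i. i \<in> J)" "light (\<lambda>i. len (string_part i) + 0) J" "I \<subseteq> J"
    using assms I(1,2) unfolding covers_def by blast
  have "\<not> random_rel B X"
  proof (rule solovay_not_random[OF J(1) _ _ _ J(2)])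
    show "semidec B (\<lambda>z. pr2 z = string_part (pr1 z))" by (intro semidec_decidable computable_intros)
    show "cyl (string_part i) = {X. \<exists>k. restr X k = string_part i}" for i by (rule cyl_iff)
    show "measure fair_coin (cyl (string_part i)) \<le> (1/2) ^ (len (string_part i) + 0)" for i
      using prob_cyl_le by simp
    \<comment> \<open>Each level of the test contributes an index tagged with that level, so there
      are infinitely many.\<close>
    have "pr1 ` {i \<in> J. X \<in> cyl (string_part i)} = UNIV"
      using I(3)[OF U(2)] J(3) by (auto simp: set_eq_iff image_iff) (metis subsetD)
    then show "infinite {i \<in> J. X \<in> cyl (string_part i)}"
      using infinite_UNIV_nat finite_imageI by metis
  qed
  then show False using B by blast
qed


section \<open>The equivalence\<close>

lemma sigma2_sets: "sigma2 A S \<Longrightarrow> S \<in> sets fair_coin"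
proof -
  assume "sigma2 A S"
  then obtain P where P: "uniformly_sigma1 A (\<lambda>n. - P n)" "S = (\<Union>n. P n)"
    unfolding sigma2_def uniformly_pi1_def by blast
  have "pi1 A (P n)" for n
    using uniformly_sigma1_sigma1[OF P(1)] by (simp add: pi1_def)
  then show ?thesis unfolding P(2) using pi1_sets by (intro sets.countable_UN) auto
qed

lemma pi1_sigma2: assumes "pi1 A P" shows "sigma2 A P"
proof -
  obtain Q where Q: "semidec A Q" "- P = {X. \<exists>k. Q (restr X k)}"
    using assms unfolding pi1_def sigma1_iff by blast
  have "uniformly_pi1 A (\<lambda>_. P)"
    unfolding uniformly_pi1_def uniformly_sigma1_iff
    by (intro exI[of _ "\<lambda>_. Q"] conjI semidec_compose[OF Q(1)] computable_intros) (simp add: Q(2))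
  then show ?thesis unfolding sigma2_def by (intro exI[of _ "\<lambda>_. P"]) simp
qed

text \<open>
  A pair \<open>i \<in> J\<close> whose oracle part is not a prefix of \<open>A\<close> is eventually discarded, so a point in
  the class \<open>\<Inter>s. W (pair n s)\<close> but outside \<open>U n\<close> lies in infinitely many cylinders of \<open>J\<close>.
\<close>

lemma sigma2_subclass_if_covers:
  assumes cov: "covers A B" and le: "A \<le>\<^sub>T jump B" and Q: "sigma2 A Q"
  shows "\<exists>S. sigma2 B S \<and> S \<subseteq> Q \<and> measure fair_coin S = measure fair_coin Q"
proof -
  obtain P where P: "uniformly_sigma1 A (\<lambda>n. - P n)" "Q = (\<Union>n. P n)"
    using Q unfolding sigma2_def uniformly_pi1_def by blast
  define U where "U n = - P n" for n
  have U: "uniformly_sigma1 A U" using P(1) unfolding U_def .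
  have v: "(1/2) ^ n * measure fair_coin (U n) \<le> (1/2) ^ n" for n by (simp add: mult_left_le)
  define w where "w i = len (string_part i) + pr1 i" for i
  obtain V I where V: "\<And>B. decidable B (\<lambda>i. V (pr1 i) (oracle_part i) (string_part i))"
    "\<And>n X. X \<in> U n \<longleftrightarrow> (\<exists>k. V n (restr A k) (restr X k))"
    and I: "semidec A (\<lambda>i. i \<in> I)" "light w I"
    "\<And>i. i \<in> I \<Longrightarrow> V (pr1 i) (oracle_part i) (string_part i) \<and> len (oracle_part i) = len (string_part i) \<and>
      oracle_part i = restr A (len (oracle_part i))"
    "\<And>n X. X \<in> U n \<Longrightarrow> \<exists>i\<in>I. pr1 i = n \<and> X \<in> cyl (string_part i)"
    using disjoint_presentation[OF U v, folded w_def] by blast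
  have "computable C w" for C unfolding w_def by (intro computable_intros)
  then obtain J where J: "semidec B (\<lambda>i. i \<in> J)" "light w J" "I \<subseteq> J"
    using cov I(1,2) unfolding covers_def by blast
  have "decidable (jump B) A" using le unfolding turing_le_def decidable_def computable_def .
  then obtain R where R: "semidec B (\<lambda>z. R (pr1 z) (pr2 z))"
    "\<And>\<tau>. \<tau> = restr A (len \<tau>) \<longleftrightarrow> (\<forall>z. R z \<tau>)"
    using prefix_Pi2 by blast
  \<comment> \<open>\<open>m\<close> codes a component and a stage: \<open>pr2 m\<close> is the
    number of conditions on the oracle part that have to be confirmed. True prefixes of
    \<open>A\<close> satisfy all of them and are never discarded.\<close>
  define good where "good m i \<longleftrightarrow> i \<in> J \<and> pr1 i = pr1 m \<and> len (oracle_part i) = len (string_part i) \<and>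
    V (pr1 i) (oracle_part i) (string_part i) \<and> (\<forall>z<pr2 m. R z (oracle_part i))" for m i
  define W where "W m = {X. \<exists>i. good m i \<and> X \<in> cyl (string_part i)}" for m
  have "W m = {X. \<exists>k i. good m i \<and> string_part i = restr X k}" for m
    unfolding W_def cyl_iff by (intro Collect_cong) (simp, metis)
  moreover have "semidec B (\<lambda>z. \<exists>i. good (pr1 z) i \<and> string_part i = pr2 z)"
    unfolding good_def
    by (intro semidec_ex semidec_and semidec_ball semidec_compose[OF J(1)] semidec_compose2[OF R(1)]
        semidec_decidable[OF decidable_compose[OF V(1)]] computable_intros | rule semidec_decidable)+
  ultimately have W: "uniformly_sigma1 B W"
    unfolding uniformly_sigma1_iff by (intro exI[of _ "\<lambda>m c. \<exists>i. good m i \<and> string_part i = c"]) blast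
  define S where "S = (\<Union>m. - W m)"
  have S: "sigma2 B S" unfolding S_def sigma2_def uniformly_pi1_def using W by (intro exI[of _ "\<lambda>m. - W m"]) simp
  have "S \<subseteq> Q"
  proof
    fix X assume "X \<in> S"
    then obtain m where m: "X \<notin> W m" unfolding S_def by blast
    show "X \<in> Q"
    proof (rule ccontr)
      assume "X \<notin> Q"
      then obtain i where i: "i \<in> I" "pr1 i = pr1 m" "X \<in> cyl (string_part i)"
        using I(4)[of X "pr1 m"] P(2) unfolding U_def by blast
      then have "good m i" using I(3)[OF i(1)] J(3) R(2) unfolding good_def by blast
      then show False using m i(3) unfolding W_def by blast
    qed
  qed
  have finite: "AE X in fair_coin. finite {i \<in> J. pr1 i = n \<and> X \<in> cyl (string_part i)}" for n
  proof -
    define D where "D i = (if i \<in> J \<and> pr1 i = n then cyl (string_part i) else {})" for i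
    \<comment> \<open>For fixed \<open>n\<close> the correction in \<open>w\<close> is undone by the
      constant \<open>2 ^ n\<close>, so lightness bounds the measures of the cylinders
      themselves.\<close>
    have "summable (\<lambda>i. 2 ^ n * (if i \<in> J then (1/2) ^ w i else 0 :: real))"
      using J(2) unfolding light_def by (rule summable_mult)
    then have "summable (\<lambda>i. measure fair_coin (D i))"
    proof (rule summable_comparison_test[rotated], intro exI[of _ 0] allI impI)
      fix i
      have "(1/2 :: real) ^ len (string_part i) = 2 ^ pr1 i * (1/2) ^ w i"
        by (simp add: w_def power_add power_divide)
      then show "norm (measure fair_coin (D i)) \<le> 2 ^ n * (if i \<in> J then (1/2) ^ w i else 0)"
        using prob_cyl_le[of "string_part i"] by (auto simp: D_def)
    qed
    then have "AE X in fair_coin. \<forall>\<^sub>F i in sequentially. X \<in> space fair_coin - D i"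
      by (intro borel_cantelli_AE1) (auto simp: D_def coin.emeasure_eq_measure)
    then show ?thesis
    proof eventually_elim
      case (elim X)
      then obtain N where N: "\<And>i. N \<le> i \<Longrightarrow> X \<notin> D i" by (auto simp: eventually_sequentially)
      have "i < N" if "i \<in> J" "pr1 i = n" "X \<in> cyl (string_part i)" for i
        using N[of i] that by (cases "N \<le> i") (auto simp: D_def)
      then have "{i \<in> J. pr1 i = n \<and> X \<in> cyl (string_part i)} \<subseteq> {..<N}" by auto
      then show ?case by (rule finite_subset) simp
    qed
  qed
  have "AE X in fair_coin. \<forall>n. finite {i \<in> J. pr1 i = n \<and> X \<in> cyl (string_part i)}"
    using finite unfolding AE_all_countable ..
  then have "AE X in fair_coin. X \<in> S \<longleftrightarrow> X \<in> Q"
  proof eventually_elim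
    case (elim X)
    have "X \<in> S" if XQ: "X \<in> Q"
    proof (rule ccontr)
      assume "X \<notin> S"
      obtain n where n: "X \<in> P n" using XQ P(2) by blast
      let ?K = "{i \<in> J. pr1 i = n \<and> X \<in> cyl (string_part i)}"
      \<comment> \<open>\<open>f i\<close> is the first condition violated by a wrong prefix. It is
        arbitrary for a true one, but as \<open>?K\<close> is finite, stage \<open>s\<close> still
        lies beyond all these values and discards every wrong prefix in \<open>?K\<close>.\<close>
      define f where "f i = (LEAST z. \<not> R z (oracle_part i))" for i
      define s where "s = Suc (\<Sum>i\<in>?K. f i)"
      have "X \<in> W (pair n s)" using \<open>X \<notin> S\<close> unfolding S_def by blast
      then obtain i where i: "good (pair n s) i" "X \<in> cyl (string_part i)" unfolding W_def by blast
      then have K: "i \<in> ?K" unfolding good_def by simp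
      have "oracle_part i \<noteq> restr A (len (oracle_part i))"
      proof
        assume "oracle_part i = restr A (len (oracle_part i))"
        moreover have "string_part i = restr X (len (string_part i))" using i(2) by (simp add: cyl_def)
        ultimately have "V n (restr A (len (string_part i))) (restr X (len (string_part i)))"
          using i(1) unfolding good_def by (metis pr_pair(1))
        then show False using V(2)[of X n] n unfolding U_def by blast
      qed
      then have "\<not> R (f i) (oracle_part i)" unfolding f_def using R(2) by (metis LeastI_ex)
      moreover have "f i < s"
        unfolding s_def using elim K by (intro le_imp_less_Suc member_le_sum) auto
      ultimately show False using i(1) unfolding good_def by simp
    qed
    then show ?case using \<open>S \<subseteq> Q\<close> by blast
  qed
  then have "measure fair_coin S = measure fair_coin Q"
    using sigma2_sets[OF S] sigma2_sets[OF Q] by (intro measure_eq_AE) auto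
  then show ?thesis using S \<open>S \<subseteq> Q\<close> by blast
qed

section \<open>Coding a set by the position of the first one\<close>

definition first_one :: "nat \<Rightarrow> cantor set" where
  "first_one k = {X. X k \<and> (\<forall>m<k. \<not> X m)}"

lemma prob_first_one: "measure fair_coin (first_one k) = (1/2) ^ Suc k"
proof -
  have "first_one k = {X. \<forall>m\<in>{..k}. X m = (m = k)}"
    unfolding first_one_def by (auto simp: le_less)
  then show ?thesis by (simp add: prob_cylinder)
qed

definition is_first_one :: "nat \<Rightarrow> nat \<Rightarrow> bool" where
  "is_first_one k c \<longleftrightarrow> k < len c \<and> nthc c k = 1 \<and> (\<forall>m<k. nthc c m = 0)"

lemma is_first_one_restr: "is_first_one k (restr X l) \<longleftrightarrow> X \<in> first_one k \<and> k < l"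
  by (auto simp: is_first_one_def first_one_def nthc_restr)

lemma decidable_is_first_one [computable_intros]:
  assumes "computable A f" "computable A g" shows "decidable A (\<lambda>x. is_first_one (f x) (g x))"
  unfolding is_first_one_def
  by (intro computable_intros assms computable_compose[OF assms(1)] computable_compose[OF assms(2)])

lemma sets_first_one: "first_one k \<in> sets fair_coin"
proof -
  have "first_one k = {X. \<exists>l. is_first_one k (restr X l)}" unfolding is_first_one_restr by auto
  then show ?thesis by simp
qed

text \<open>
  A set \<open>H\<close> is coded into the \<open>\<Pi>\<^sub>1\<close> class of all points whose first one, if any, is in \<open>H\<close>.
\<close>

lemma semidec_jump_if_subclasses:
  assumes sub: "\<And>P. pi1 A P \<Longrightarrow> \<exists>S. sigma2 B S \<and> S \<subseteq> P \<and> measure fair_coin S = measure fair_coin P"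
    and H: "decidable A H"
  shows "semidec (jump B) H"
proof -
  define P where "P = {X. \<forall>k. X \<in> first_one k \<longrightarrow> H k}"
  have "- P = {X. \<exists>l k. is_first_one k (restr X l) \<and> \<not> H k}"
    unfolding P_def is_first_one_restr by blast
  moreover have "semidec A (\<lambda>c. \<exists>k. is_first_one k c \<and> \<not> H k)"
    by (intro semidec_ex semidec_decidable computable_intros decidable_compose[OF H])
  ultimately have P: "pi1 A P" unfolding pi1_def sigma1_iff by blast
  obtain S where S: "sigma2 B S" "S \<subseteq> P" "measure fair_coin S = measure fair_coin P"
    using sub[OF P] by blast
  obtain F where F: "uniformly_sigma1 B (\<lambda>n. - F n)" "S = (\<Union>n. F n)"
    using S(1) unfolding sigma2_def uniformly_pi1_def by blast
  have setsF: "F n \<in> sets fair_coin" for n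
    using pi1_sets[of B "F n"] uniformly_sigma1_sigma1[OF F(1)] by (simp add: pi1_def)
  have setsS: "S \<in> sets fair_coin" using S(1) by (rule sigma2_sets)
  have setsP: "P \<in> sets fair_coin" using P by (rule pi1_sets)
  \<comment> \<open>If \<open>H k\<close>, the cylinder lies in \<open>P\<close> and has positive
    measure, so a subclass of full measure cannot meet it in a null set. Otherwise it is disjoint
    from \<open>P\<close>.\<close>
  have H_iff: "H k \<longleftrightarrow> (\<exists>n. measure fair_coin (F n \<inter> first_one k) > 0)" for k
  proof
    assume "H k"
    then have sub: "first_one k \<subseteq> P"
      unfolding P_def first_one_def by (auto simp: linorder_neq_iff) (metis linorder_neqE_nat)
    show "\<exists>n. measure fair_coin (F n \<inter> first_one k) > 0"
    proof (rule ccontr)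
      assume "\<nexists>n. measure fair_coin (F n \<inter> first_one k) > 0"
      then have "F n \<inter> first_one k \<in> null_sets fair_coin" for n
        using setsF sets_first_one
        by (intro null_setsI) (auto simp: coin.emeasure_eq_measure not_less measure_le_0_iff)
      then have "(\<Union>n. F n \<inter> first_one k) \<in> null_sets fair_coin" by (intro null_sets_UN) auto
      then have "measure fair_coin (S \<inter> first_one k) = 0"
        unfolding F(2) by (simp add: measure_eq_0_null_sets)
      then have "measure fair_coin (S \<union> first_one k) = measure fair_coin S + measure fair_coin (first_one k)"
        using measure_Un3[of S fair_coin "first_one k"] setsS sets_first_one
        by (simp add: coin.fmeasurable_eq_sets)
      moreover have "measure fair_coin (S \<union> first_one k) \<le> measure fair_coin P"
        using S(2) sub setsP by (intro coin.finite_measure_mono) auto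
      moreover have "measure fair_coin (first_one k) > 0" by (simp add: prob_first_one)
      ultimately show False using S(3) by linarith
    qed
  next
    assume "\<exists>n. measure fair_coin (F n \<inter> first_one k) > 0"
    then obtain n where "measure fair_coin (F n \<inter> first_one k) > 0" ..
    then have "F n \<inter> first_one k \<noteq> {}" by auto
    then show "H k" using S(2) unfolding F(2) P_def by blast
  qed
  obtain G where G: "semidec B (\<lambda>z. G (pr1 z) (pr2 z))" "\<And>n. - F n = {X. \<exists>j. G n (restr X j)}"
    using F(1) unfolding uniformly_sigma1_iff by blast
  define E where "E i c \<longleftrightarrow> is_first_one (pr2 i) c \<and> (\<exists>j. j \<le> len c \<and> G (pr1 i) (takec j c))" for i c
  have E: "semidec B (\<lambda>z. E (pr1 z) (pr2 z))"
    unfolding E_def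
    by (intro semidec_ex semidec_and semidec_compose2[OF G(1)] computable_intros | rule semidec_decidable)+
  have EF: "{X. \<exists>l. E (pair n k) (restr X l)} = first_one k - F n" for n k
  proof (intro set_eqI iffI)
    fix X assume "X \<in> {X. \<exists>l. E (pair n k) (restr X l)}"
    then show "X \<in> first_one k - F n"
      using G(2)[of n] unfolding E_def by (auto simp: is_first_one_restr set_eq_iff)
  next
    fix X assume X: "X \<in> first_one k - F n"
    then obtain j where j: "G n (restr X j)" using G(2)[of n] by blast
    then have "E (pair n k) (restr X (max j (Suc k)))"
      using X unfolding E_def by (auto simp: is_first_one_restr min_def intro!: exI[of _ j])
    then show "X \<in> {X. \<exists>l. E (pair n k) (restr X l)}" by blast
  qed
  \<comment> \<open>At \<open>triple k n q\<close>, this says that \<open>F n\<close> meets the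
    cylinder in measure less than \<open>(1/2) ^ q * (1/2) ^ Suc k\<close>. It is phrased through
    the open difference in order to be semidecidable in \<open>B\<close>; the jump then decides it,
    and positive measure means failure for some \<open>q\<close>.\<close>
  define T where "T x \<longleftrightarrow> real (2 ^ pr2 (pr2 x) - 1) / 2 ^ (pr2 (pr2 x) + Suc (pr1 x)) <
    measure fair_coin (first_one (pr1 x) - F (pr1 (pr2 x)))" for x
  have "semidec B T"
    using semidec_compose[OF semidec_measure_gt[OF E], of "\<lambda>x. pair (pair (pr1 (pr2 x)) (pr1 x))
        (pair (2 ^ pr2 (pr2 x) - 1) (pr2 (pr2 x) + Suc (pr1 x)))"]
    unfolding T_def[abs_def] by (simp add: EF computable_intros del: add_Suc_right power_Suc)
  then have T: "decidable (jump B) T" by (rule decidable_jump)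
  have H': "(\<exists>n q. \<not> T (pair k (pair n q))) \<longleftrightarrow> H k" for k
  proof -
    have "(measure fair_coin (F n \<inter> first_one k) > 0) \<longleftrightarrow> (\<exists>q. \<not> T (pair k (pair n q)))" for n
    proof -
      let ?m = "measure fair_coin (F n \<inter> first_one k)"
      have "real (2 ^ q - 1) / 2 ^ (q + Suc k) = (1/2) ^ Suc k - (1/2) ^ q * (1/2) ^ Suc k" for q
        by (simp add: of_nat_diff power_add field_simps power_divide)
      moreover have "measure fair_coin (first_one k - F n) = (1/2) ^ Suc k - ?m"
        using coin.finite_measure_Diff'[OF sets_first_one setsF] by (simp only: prob_first_one Int_commute)
      ultimately have T: "\<not> T (pair k (pair n q)) \<longleftrightarrow> (1/2) ^ q * (1/2) ^ Suc k \<le> ?m" for q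
        unfolding T_def pr_pair by (simp only:) linarith
      show ?thesis unfolding T
      proof
        assume "?m > 0"
        then obtain q where "(1/2) ^ q < ?m" using real_arch_pow_inv[of ?m "1/2"] by auto
        moreover have "(1/2 :: real) ^ q * (1/2) ^ Suc k \<le> (1/2) ^ q * 1"
          by (intro mult_left_mono power_le_one) auto
        ultimately show "\<exists>q. (1/2) ^ q * (1/2) ^ Suc k \<le> ?m" by (intro exI[of _ q]) linarith
      next
        assume "\<exists>q. (1/2) ^ q * (1/2) ^ Suc k \<le> ?m"
        then obtain q where "(1/2) ^ q * (1/2) ^ Suc k \<le> ?m" ..
        moreover have "(0::real) < (1/2) ^ q * (1/2) ^ Suc k" by simp
        ultimately show "?m > 0" by linarith
      qed
    qed
    then show ?thesis unfolding H_iff by blast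
  qed
  have "semidec (jump B) (\<lambda>k. \<exists>n q. \<not> T (pair k (pair n q)))"
    by (intro semidec_ex semidec_decidable computable_intros decidable_compose[OF T])
  then show ?thesis unfolding H' .
qed

text \<open>Both \<open>A\<close> and its complement are decidable in \<open>A\<close>, so both can
  be coded and are semidecidable in the jump; Post's theorem then applies.\<close>

lemma turing_le_jump_if_subclasses:
  assumes sub: "\<And>P. pi1 A P \<Longrightarrow> \<exists>S. sigma2 B S \<and> S \<subseteq> P \<and> measure fair_coin S = measure fair_coin P"
  shows "A \<le>\<^sub>T jump B"
proof -
  have A: "decidable A A" using computable_oracle[OF computable_id] .
  have "decidable (jump B) A"
    by (rule decidable_post; rule semidec_jump_if_subclasses[OF sub]) (auto intro: A decidable_not)
  then show ?thesis unfolding turing_le_def decidable_def computable_def .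
qed

theorem theorem3p2:
  fixes A B :: cantor
  shows "((A \<le>\<^sub>T jump B \<and> A \<le>\<^sub>L\<^sub>R B) \<longleftrightarrow>
          (\<forall>P. pi1 A P \<longrightarrow> (\<exists>S. sigma2 B S \<and> S \<subseteq> P \<and> measure fair_coin S = measure fair_coin P)))
       \<and> ((\<forall>P. pi1 A P \<longrightarrow> (\<exists>S. sigma2 B S \<and> S \<subseteq> P \<and> measure fair_coin S = measure fair_coin P)) \<longleftrightarrow>
          (\<forall>Q. sigma2 A Q \<longrightarrow> (\<exists>S. sigma2 B S \<and> S \<subseteq> Q \<and> measure fair_coin S = measure fair_coin Q)))"
    (is "(?i \<longleftrightarrow> ?ii) \<and> (?ii \<longleftrightarrow> ?iii)")
proof -
  have "?i \<Longrightarrow> ?iii" using sigma2_subclass_if_covers covers_if_LR_le by blast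
  moreover have "?iii \<Longrightarrow> ?ii" using pi1_sigma2 by blast
  moreover have "?i" if "?ii"
    using turing_le_jump_if_subclasses LR_le_if_covers[OF covers_if_subclasses] that by blast
  ultimately show ?thesis by blast
qed

end
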